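(* Let $p\ge 1$ and $n_1\le n_2\le\cdots\le n_p$ be positive integers with $n_1\cdots n_{p-1}\le n_p$, let $N=n_1\cdots n_p$, and let $k$ be a positive integer. Then: (a) $\Sigma^k(n_1,\ldots,n_p)$ is a connected, compact subset of $\Sigma(n_1,\ldots,n_p)$. In particular, if $\Sigma^k(n_1,\ldots,n_p)\neq\Sigma(n_1,\ldots,n_p)$, then $\Sigma^k(n_1,\ldots,n_p)$ is not dense in $\Sigma(n_1,\ldots,n_p)$ and its complement in $\Sigma(n_1,\ldots,n_p)$ is (relatively) open. (b) If $k<n_1^2\cdots n_{p-1}^2$, then $\Sigma^k(n_1,\ldots,n_p)$ has measure $0$ in $\Sigma(n_1,\ldots,n_p)$. (c) If $k\ge n_1^2\cdots n_{p-1}^2$, then $\Sigma^k(n_1,\ldots,n_p)$ has positive measure in $\Sigma(n_1,\ldots,n_p)$, and in fact contains a nonempty open subset.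
   Context: For a positive integer $w$, a density matrix on $\mathbb{C}^w$ is a $w\times w$ complex Hermitian positive semi-definite matrix of trace $1$; let $\mathcal{DM}(w)$ denote the set of these. Let $N=n_1\cdots n_p$ and identify $\mathbb{C}^N=\mathbb{C}^{n_1}\otimes\cdots\otimes\mathbb{C}^{n_p}$. A product density matrix is one of the form $A_1\otimes\cdots\otimes A_p$ with $A_i\in\mathcal{DM}(n_i)$. $\Sigma(n_1,\ldots,n_p)\subset\mathcal{DM}(N)$ is the set of separable density matrices, i.e. convex combinations of (finitely many) product density matrices. $\Sigma^k(n_1,\ldots,n_p)$ is the set of $A\in\Sigma(n_1,\ldots,n_p)$ that can be written as a convex combination of at most $k$ product density matrices (i.e. whose optimal ensemble length is $k$ or fewer). Measure is $(N^2-1)$-dimensional Lebesgue measure on the real affine hyperplane $\tau_1(N)$ of $N\times N$ complex Hermitian matrices of trace $1$ (which contains $\Sigma(n_1,\ldots,n_p)$); "open" means open in $\tau_1(N)$ (resp. relatively open in $\Sigma(n_1,\ldots,n_p)$ where stated). *)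

theory Defs
  imports "HOL-Analysis.Analysis" "HOL-Probability.Probability"
begin

text \<open>A w x w complex matrix is represented as a function on index pairs that vanishes
outside the range (i,j) with i,j < w. The type nat x nat => complex carries the product
topology, which on such matrices is the usual Euclidean topology of w x w complex matrices.\<close>

type_synonym cmat = "nat \<times> nat \<Rightarrow> complex"

definition supported :: "nat \<Rightarrow> cmat \<Rightarrow> bool" where
  "supported w A \<longleftrightarrow> (\<forall>i j. \<not>(i < w \<and> j < w) \<longrightarrow> A (i, j) = 0)"

definition hermitian :: "nat \<Rightarrow> cmat \<Rightarrow> bool" where
  "hermitian w A \<longleftrightarrow> (\<forall>i<w. \<forall>j<w. A (i, j) = cnj (A (j, i)))"

definition psd :: "nat \<Rightarrow> cmat \<Rightarrow> bool" where
  "psd w A \<longleftrightarrow> (\<forall>v :: nat \<Rightarrow> complex.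
      (\<Sum>i<w. \<Sum>j<w. cnj (v i) * A (i, j) * v j) \<in> \<real> \<and>
      0 \<le> Re (\<Sum>i<w. \<Sum>j<w. cnj (v i) * A (i, j) * v j))"

definition trace :: "nat \<Rightarrow> cmat \<Rightarrow> complex" where
  "trace w A = (\<Sum>i<w. A (i, i))"

definition DM :: "nat \<Rightarrow> cmat set" where
  "DM w = {A. supported w A \<and> hermitian w A \<and> psd w A \<and> trace w A = 1}"

definition tau1 :: "nat \<Rightarrow> cmat set" where
  "tau1 w = {A. supported w A \<and> hermitian w A \<and> trace w A = 1}"

definition kron :: "nat \<Rightarrow> cmat \<Rightarrow> cmat \<Rightarrow> cmat" where
  "kron m A B = (\<lambda>(i, j). A (i div m, j div m) * B (i mod m, j mod m))"

fun tensor_list :: "(nat \<times> cmat) list \<Rightarrow> cmat" where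
  "tensor_list [] = (\<lambda>(i, j). if i = 0 \<and> j = 0 then 1 else 0)"
| "tensor_list ((n, A) # rest) = kron (prod_list (map fst rest)) A (tensor_list rest)"

definition prodDM :: "nat list \<Rightarrow> cmat set" where
  "prodDM ns = {tensor_list (zip ns As) | As. length As = length ns \<and>
                   (\<forall>i<length ns. As ! i \<in> DM (ns ! i))}"

definition Sigmak :: "nat list \<Rightarrow> nat \<Rightarrow> cmat set" where
  "Sigmak ns k = {A. \<exists>m \<le> k. \<exists>(c :: nat \<Rightarrow> real) (P :: nat \<Rightarrow> cmat).
      (\<forall>i<m. 0 \<le> c i \<and> P i \<in> prodDM ns) \<and> (\<Sum>i<m. c i) = 1 \<and>
      A = (\<lambda>x. \<Sum>i<m. complex_of_real (c i) * P i x)}"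

definition Sigma :: "nat list \<Rightarrow> cmat set" where
  "Sigma ns = (\<Union>k. Sigmak ns k)"

text \<open>Real affine coordinates on tau_1(w): for i<j the real part of entry (i,j), for i>j the
imaginary part of entry (j,i), for i=j the real diagonal entry, omitting the last diagonal
entry (determined by trace 1). This is an affine bijection of tau_1(w) onto R^(w^2-1).\<close>
definition coord_index :: "nat \<Rightarrow> (nat \<times> nat) set" where
  "coord_index w = {(i, j). i < w \<and> j < w} - {(w - 1, w - 1)}"

definition coord :: "nat \<Rightarrow> cmat \<Rightarrow> (nat \<times> nat \<Rightarrow> real)" where
  "coord w A = restrict (\<lambda>(i, j). if i \<le> j then Re (A (i, j)) else Im (A (j, i))) (coord_index w)"

definition leb_tau :: "nat \<Rightarrow> (nat \<times> nat \<Rightarrow> real) measure" where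
  "leb_tau w = completion (PiM (coord_index w) (\<lambda>_. lborel))"

end

theory Submission
  imports Defs
begin

text \<open>
  Write \<open>ns = ms @ [n]\<close> and \<open>M = prod_list ms\<close>, so that product states are \<open>A \<otimes> B\<close> with \<open>A\<close> a product
  state of size \<open>M\<close> and \<open>B\<close> any state of size \<open>n \<ge> M\<close>.

  Passing from \<open>\<Sigma>\<^sup>k\<close> to \<open>\<Sigma>\<^sup>k\<^sup>+\<^sup>1\<close> means mixing with one more product state, which makes \<open>\<Sigma>\<^sup>k\<close> a
  continuous image of a compact connected set.

  A sum of \<open>k\<close> product states, realigned as a matrix with rows \<open>(a, b)\<close> and columns \<open>(c, d)\<close>, has
  rank at most \<open>k\<close>. If \<open>k < M\<^sup>2\<close>, its square block \<open>c, d < M\<close> is singular. There is a traceless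
  hermitian direction \<open>D\<close> whose realigned block is an invertible diagonal matrix, so a line
  \<open>A + t D\<close> meets \<open>\<Sigma>\<^sup>k\<close> only when \<open>t\<close> is an eigenvalue of a fixed matrix, that is finitely often.
  A measurable set meeting all parallel lines in countable sets is null.

  For \<open>k \<ge> M\<^sup>2\<close>, choose \<open>M\<^sup>2\<close> product states \<open>P\<^sub>q\<close> of size \<open>M\<close> that span all matrices. Every hermitian
  matrix is \<open>\<Sum>\<^sub>q P\<^sub>q \<otimes> X\<^sub>q\<close> with hermitian \<open>X\<^sub>q\<close> bounded linearly by it, so small perturbations of
  \<open>\<Sum>\<^sub>q P\<^sub>q \<otimes> \<alpha> 1\<close> keep positive semidefinite second factors and stay in \<open>\<Sigma>\<^sup>k\<close>.
\<close>

subsection \<open>Kronecker products and product density matrices\<close>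

lemma supportedD: "supported w A \<Longrightarrow> \<not> (i < w \<and> j < w) \<Longrightarrow> A (i, j) = 0"
  by (simp add: supported_def)

lemma hermitian_cnj: "hermitian w A \<Longrightarrow> i < w \<Longrightarrow> j < w \<Longrightarrow> cnj (A (j, i)) = A (i, j)"
  unfolding hermitian_def by metis

lemma hermitianI:
  "(\<And>i j. i < w \<Longrightarrow> j < w \<Longrightarrow> cnj (A (j, i)) = A (i, j)) \<Longrightarrow> hermitian w A"
  unfolding hermitian_def by metis

lemma mult_add_less_mult:
  fixes a c :: nat
  assumes "a < m" "c < n"
  shows "a * n + c < m * n"
proof -
  have "a * n + c < Suc a * n" using assms by simp
  also have "\<dots> \<le> m * n" using assms by (intro mult_le_mono1) simp
  finally show ?thesis .
qed

text \<open>Row-major numbering: \<open>a * n + b\<close> and \<open>(i div n, i mod n)\<close> are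
  inverse to each other, so sums over the index of a tensor product become double sums over the
  indices of its factors.\<close>

lemma sum_divmod:
  fixes f :: "nat \<Rightarrow> nat \<Rightarrow> 'a::comm_monoid_add"
  assumes "n > 0"
  shows "(\<Sum>i<m * n. f (i div n) (i mod n)) = (\<Sum>a<m. \<Sum>b<n. f a b)"
proof -
  have "(\<Sum>a<m. \<Sum>b<n. f a b) = (\<Sum>(a, b)\<in>{..<m} \<times> {..<n}. f a b)"
    by (simp add: sum.cartesian_product)
  also have "\<dots> = (\<Sum>i<m * n. f (i div n) (i mod n))"
    by (rule sum.reindex_bij_witness
        [where i = "\<lambda>i. (i div n, i mod n)" and j = "\<lambda>(a, b). a * n + b"])
      (use assms in \<open>auto simp: less_mult_imp_div_less mult_add_less_mult\<close>)
  finally show ?thesis by simp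
qed

lemma less_divmod:
  fixes i :: nat
  assumes "n > 0"
  shows "i < m * n \<longleftrightarrow> i div n < m \<and> i mod n < n"
  using assms by (simp add: less_mult_imp_div_less div_less_iff_less_mult)

lemma kron_apply: "kron n A B (i, j) = A (i div n, j div n) * B (i mod n, j mod n)"
  by (simp add: kron_def)

lemma kron_block:
  assumes "c < n" "d < n"
  shows "kron n A B (a * n + c, b * n + d) = A (a, b) * B (c, d)"
  using assms by (simp add: kron_apply)

text \<open>Quotient and remainder by \<open>m * n\<close> arise by dividing first by
  \<open>n\<close> and then by \<open>m\<close>, so both bracketings read the same three digits of
  each index.\<close>

lemma kron_assoc:
  assumes "n > 0"
  shows "kron (m * n) A (kron n B C) = kron n (kron m A B) C"
proof -
  have *: "i mod (m * n) div n = i div n mod m" "i mod (m * n) mod n = i mod n"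
    "i div (m * n) = i div n div m" for i :: nat
    using assms
    by (simp_all add: mult.commute[of m n] mod_mult2_eq div_mult2_eq)
  show ?thesis
    by (rule ext) (auto simp: kron_def * split: prod.splits)
qed

lemma supported_kron:
  assumes "supported m A" "supported n B" "n > 0"
  shows "supported (m * n) (kron n A B)"
  using assms by (auto simp: supported_def kron_apply less_divmod)

lemma hermitian_kron:
  assumes "hermitian m A" "hermitian n B" "n > 0"
  shows "hermitian (m * n) (kron n A B)"
  using assms by (intro hermitianI) (simp add: kron_apply less_divmod hermitian_cnj)

lemma trace_kron:
  assumes "n > 0"
  shows "trace (m * n) (kron n A B) = trace m A * trace n B"
  by (simp add: trace_def kron_apply sum_divmod[OF assms, where f = "\<lambda>a c. A (a, a) * B (c, c)"]
      sum_product)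

lemma kron_in_tau1:
  assumes "A \<in> tau1 m" "B \<in> tau1 n" "n > 0"
  shows "kron n A B \<in> tau1 (m * n)"
  using assms by (auto simp: tau1_def supported_kron hermitian_kron trace_kron)

lemma DM_subset_tau1: "DM w \<subseteq> tau1 w"
  by (auto simp: DM_def tau1_def)

section \<open>Product states as iterated Kronecker products\<close>

lemma prodDM_Nil: "prodDM [] = {tensor_list []}"
  by (auto simp: prodDM_def)

lemma prodDM_Cons:
  "prodDM (n # ns) = (\<lambda>(A, B). kron (prod_list ns) A B) ` (DM n \<times> prodDM ns)"
proof (intro equalityI subsetI)
  fix X assume "X \<in> prodDM (n # ns)"
  then obtain As where As: "X = tensor_list (zip (n # ns) As)" "length As = length (n # ns)"
    "\<forall>i<length (n # ns). As ! i \<in> DM ((n # ns) ! i)"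
    unfolding prodDM_def by blast
  then obtain A As' where [simp]: "As = A # As'" by (cases As) auto
  have "As' ! i \<in> DM (ns ! i)" if "i < length ns" for i
    using As(3)[rule_format, of "Suc i"] that by simp
  moreover have "A \<in> DM n" using As(3)[rule_format, of 0] by simp
  ultimately have "A \<in> DM n" "tensor_list (zip ns As') \<in> prodDM ns"
    using As(2) unfolding prodDM_def by auto
  moreover have "X = kron (prod_list ns) A (tensor_list (zip ns As'))"
    using As by simp
  ultimately show "X \<in> (\<lambda>(A, B). kron (prod_list ns) A B) ` (DM n \<times> prodDM ns)" by auto
next
  fix X assume "X \<in> (\<lambda>(A, B). kron (prod_list ns) A B) ` (DM n \<times> prodDM ns)"
  then obtain A As where As: "A \<in> DM n" "length As = length ns"
    "\<forall>i<length ns. As ! i \<in> DM (ns ! i)" "X = kron (prod_list ns) A (tensor_list (zip ns As))"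
    unfolding prodDM_def by auto
  have "\<forall>i<length (n # ns). (A # As) ! i \<in> DM ((n # ns) ! i)"
    using As by (auto simp: nth_Cons split: nat.splits)
  moreover have "X = tensor_list (zip (n # ns) (A # As))" using As by simp
  ultimately show "X \<in> prodDM (n # ns)"
    unfolding prodDM_def using As(2) by (intro CollectI exI[of _ "A # As"]) (simp del: tensor_list.simps)
qed

lemma kron_Nil_right: "kron 1 A (tensor_list []) = A"
  by (rule ext) (auto simp: kron_def split: prod.splits)

text \<open>The empty tensor is the 1 by 1 identity. Beyond the first \<open>n\<close> rows or
  columns it makes the product vanish, which agrees with \<open>B\<close> because of its
  support.\<close>

lemma kron_Nil_left:
  assumes "supported n B" "n > 0"
  shows "kron n (tensor_list []) B = B"
proof (rule ext, clarify)
  fix i j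
  show "kron n (tensor_list []) B (i, j) = B (i, j)"
    using assms supportedD[OF assms(1), of i j] by (auto simp: kron_def div_eq_0_iff)
qed

text \<open>\<open>tensor_list\<close> splits off the first factor, whereas the argument singles out
  the last and largest one; associativity moves the split there.\<close>

lemma prodDM_snoc:
  assumes "n > 0"
  shows "prodDM (ms @ [n]) = (\<lambda>(A, B). kron n A B) ` (prodDM ms \<times> DM n)"
proof (induction ms)
  case Nil
  have *: "kron n (tensor_list []) B = B" if "B \<in> DM n" for B
    using that assms by (intro kron_Nil_left) (auto simp: DM_def)
  show ?case
    by (auto simp: prodDM_Cons prodDM_Nil image_iff kron_Nil_right[unfolded One_nat_def] * simp del: tensor_list.simps)
next
  case (Cons m ms)
  have "prodDM ((m # ms) @ [n])
    = (\<lambda>(A, B). kron (prod_list ms * n) A B) ` (DM m \<times> prodDM (ms @ [n]))"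
    by (simp add: prodDM_Cons)
  also have "\<dots> = {kron (prod_list ms * n) A (kron n B C) | A B C.
      A \<in> DM m \<and> B \<in> prodDM ms \<and> C \<in> DM n}"
    unfolding Cons by (auto simp: image_iff)
  also have "\<dots> = (\<lambda>(A, B). kron n A B) ` (prodDM (m # ms) \<times> DM n)"
    unfolding prodDM_Cons by (auto simp: image_iff kron_assoc[OF assms])
  finally show ?case .
qed

lemma prodDM_subset_tau1:
  assumes "\<forall>n\<in>set ns. n > 0"
  shows "prodDM ns \<subseteq> tau1 (prod_list ns)"
  using assms
proof (induction ns)
  case Nil
  show ?case
    by (auto simp: prodDM_Nil tau1_def supported_def trace_def intro!: hermitianI)
next
  case (Cons n ns)
  have "prod_list ns > 0" using Cons.prems by (induction ns) auto
  then show ?case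
    using Cons DM_subset_tau1 by (auto simp: prodDM_Cons intro!: kron_in_tau1)
qed

section \<open>Convex combinations of product states\<close>

lemma tau1_convex_sum:
  assumes "\<And>i. i < m \<Longrightarrow> P i \<in> tau1 w" "(\<Sum>i<m. c i) = (1::real)"
  shows "(\<lambda>x. \<Sum>i<m. complex_of_real (c i) * P i x) \<in> tau1 w"
proof -
  have "trace w (\<lambda>x. \<Sum>i<m. complex_of_real (c i) * P i x)
      = (\<Sum>i<m. complex_of_real (c i) * trace w (P i))"
    unfolding trace_def by (subst sum.swap) (simp add: sum_distrib_left)
  also have "\<dots> = of_real (\<Sum>i<m. c i)"
    using assms(1) by (auto simp: tau1_def)
  finally have "trace w (\<lambda>x. \<Sum>i<m. complex_of_real (c i) * P i x) = 1"
    using assms(2) by simp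
  moreover have "supported w (\<lambda>x. \<Sum>i<m. complex_of_real (c i) * P i x)"
    using assms(1) by (auto simp: supported_def tau1_def intro!: sum.neutral)
  moreover have "hermitian w (\<lambda>x. \<Sum>i<m. complex_of_real (c i) * P i x)"
    using assms(1) hermitian_cnj[of w] by (intro hermitianI) (simp add: tau1_def)
  ultimately show ?thesis by (simp add: tau1_def)
qed

lemma Sigmak_subset_tau1:
  assumes "\<forall>n\<in>set ns. n > 0"
  shows "Sigmak ns k \<subseteq> tau1 (prod_list ns)"
  using tau1_convex_sum prodDM_subset_tau1[OF assms] unfolding Sigmak_def by blast

text \<open>Introduction rule: a bijection with an initial segment of the naturals renumbers the
  ensemble.\<close>

lemma Sigmak_I:
  assumes "finite I" "card I \<le> k" "\<And>i. i \<in> I \<Longrightarrow> 0 \<le> c i" "\<And>i. i \<in> I \<Longrightarrow> P i \<in> prodDM ns"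
    "(\<Sum>i\<in>I. c i) = 1" "A = (\<lambda>x. \<Sum>i\<in>I. complex_of_real (c i) * P i x)"
  shows "A \<in> Sigmak ns k"
proof -
  obtain h where h: "bij_betw h {..<card I} I"
    using ex_bij_betw_nat_finite[OF assms(1)] by (auto simp: atLeast0LessThan)
  have "(\<Sum>i<card I. c (h i)) = 1" using sum.reindex_bij_betw[OF h, of c] assms(5) by simp
  moreover have "A = (\<lambda>x. \<Sum>i<card I. complex_of_real (c (h i)) * P (h i) x)"
    unfolding assms(6)
    by (rule ext) (rule sum.reindex_bij_betw[OF h, symmetric])
  moreover have "\<forall>i<card I. 0 \<le> c (h i) \<and> P (h i) \<in> prodDM ns"
    using h assms(3,4) by (auto simp: bij_betw_def)
  ultimately show ?thesis
    unfolding Sigmak_def using assms(2)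
    by (intro CollectI exI[of _ "card I"] conjI exI[of _ "\<lambda>i. c (h i)"] exI[of _ "\<lambda>i. P (h i)"])
qed

subsection \<open>Compactness and connectedness\<close>

lemma kron_continuous: "continuous_on S (\<lambda>(A, B). kron n A B)"
  unfolding case_prod_unfold kron_def
  by (intro continuous_on_coordinatewise_then_product continuous_intros
      continuous_on_compose2[OF continuous_on_product_coordinates continuous_on_fst]
      continuous_on_compose2[OF continuous_on_product_coordinates continuous_on_snd]) auto

text \<open>This mixing map serves twice: for segments between two states, and for adjoining one
  product state to an ensemble.\<close>

lemma continuous_on_mix:
  "continuous_on S (\<lambda>(s :: real, X :: cmat, P :: cmat). (\<lambda>x. of_real (1 - s) * X x + of_real s * P x))"
  unfolding case_prod_unfold
  by (intro continuous_on_coordinatewise_then_product continuous_intros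
      continuous_on_compose2[OF continuous_on_product_coordinates continuous_on_fst]
      continuous_on_compose2[OF continuous_on_product_coordinates continuous_on_snd]) auto

section \<open>Compactness and connectedness of the set of density matrices\<close>

lemma quadratic_form_two:
  fixes i j w :: nat and z :: complex and A :: cmat
  assumes "i < w" "j < w" "i \<noteq> j"
  defines "v \<equiv> \<lambda>k. if k = i then 1 else if k = j then z else 0"
  shows "(\<Sum>k<w. \<Sum>l<w. cnj (v k) * A (k, l) * v l)
    = A (i, i) + A (i, j) * z + cnj z * A (j, i) + cnj z * A (j, j) * z"
proof -
  have *: "(\<Sum>k<w. f k) = f i + f j" if "\<And>k. k \<noteq> i \<Longrightarrow> k \<noteq> j \<Longrightarrow> f k = 0" for f :: "nat \<Rightarrow> complex"
  proof -
    have "(\<Sum>k<w. f k) = (\<Sum>k\<in>{i, j}. f k)"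
      using assms that by (intro sum.mono_neutral_right) auto
    then show ?thesis using assms by simp
  qed
  have "(\<Sum>l<w. cnj (v k) * A (k, l) * v l)
      = cnj (v k) * A (k, i) * v i + cnj (v k) * A (k, j) * v j" for k
    by (rule *) (simp add: v_def)
  then have "(\<Sum>k<w. \<Sum>l<w. cnj (v k) * A (k, l) * v l)
      = (\<Sum>k<w. cnj (v k) * A (k, i) * v i + cnj (v k) * A (k, j) * v j)"
    by simp
  also have "\<dots> = (cnj (v i) * A (i, i) * v i + cnj (v i) * A (i, j) * v j)
      + (cnj (v j) * A (j, i) * v i + cnj (v j) * A (j, j) * v j)"
    by (rule *) (simp add: v_def)
  finally show ?thesis using assms by (simp add: v_def)
qed

lemma quadratic_form_one:
  fixes i w :: nat and A :: cmat
  assumes "i < w"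
  defines "v \<equiv> \<lambda>k. if k = i then (1::complex) else 0"
  shows "(\<Sum>k<w. \<Sum>l<w. cnj (v k) * A (k, l) * v l) = A (i, i)"
proof -
  have *: "(\<Sum>k<w. f k) = f i" if "\<And>k. k \<noteq> i \<Longrightarrow> f k = 0" for f :: "nat \<Rightarrow> complex"
  proof -
    have "(\<Sum>k<w. f k) = (\<Sum>k\<in>{i}. f k)"
      using assms that by (intro sum.mono_neutral_right) auto
    then show ?thesis by simp
  qed
  have "(\<Sum>k<w. \<Sum>l<w. cnj (v k) * A (k, l) * v l) = (\<Sum>k<w. cnj (v k) * A (k, i) * v i)"
    by (intro sum.cong refl *) (simp add: v_def)
  also have "\<dots> = cnj (v i) * A (i, i) * v i"
    by (rule *) (simp add: v_def)
  finally show ?thesis by (simp add: v_def)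
qed

lemma DM_quadratic_form_nonneg:
  "A \<in> DM w \<Longrightarrow> 0 \<le> Re (\<Sum>i<w. \<Sum>j<w. cnj (v i) * A (i, j) * v j)"
  by (simp add: DM_def psd_def)

lemma DM_diag:
  assumes "A \<in> DM w" "i < w"
  shows "0 \<le> Re (A (i, i))" "Re (A (i, i)) \<le> 1"
proof -
  have nn: "0 \<le> Re (A (j, j))" if "j < w" for j
    using DM_quadratic_form_nonneg[OF assms(1), of "\<lambda>k. if k = j then 1 else 0"]
    unfolding quadratic_form_one[OF that] .
  then show "0 \<le> Re (A (i, i))" using assms by simp
  have "Re (A (i, i)) \<le> (\<Sum>j<w. Re (A (j, j)))"
    using assms(2) nn by (intro member_le_sum) auto
  also have "\<dots> = Re (trace w A)" by (simp add: trace_def)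
  finally show "Re (A (i, i)) \<le> 1" using assms(1) by (simp add: DM_def)
qed

text \<open>Diagonal entries lie between 0 and 1. Positivity on the vectors
  \<open>e_i + z e_j\<close> with \<open>z\<close> among 1, -1, \<i>, -\<i> bounds the real and
  imaginary parts of an off-diagonal entry by the mean of two diagonal entries.\<close>

lemma DM_bounded:
  assumes "A \<in> DM w"
  shows "norm (A (i, j)) \<le> 2"
proof (cases "i < w \<and> j < w")
  case False
  then show ?thesis using assms supportedD[of w A i j] by (simp add: DM_def)
next
  case ij: True
  have h: "cnj (A (k, l)) = A (l, k)" if "k < w" "l < w" for k l
    using hermitian_cnj[of w A l k] assms that by (simp add: DM_def)
  have "\<bar>Re (A (i, j))\<bar> \<le> 1 \<and> \<bar>Im (A (i, j))\<bar> \<le> 1"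
  proof (cases "i = j")
    case True
    have "Im (A (i, i)) = 0" using h[of i i] ij by (simp add: complex_eq_iff)
    then show ?thesis using DM_diag[OF assms, of i] ij True by simp
  next
    case False
    have ge: "0 \<le> Re (A (i, i) + A (i, j) * z + cnj z * A (j, i) + cnj z * A (j, j) * z)" for z
      using DM_quadratic_form_nonneg[OF assms,
          of "\<lambda>k. if k = i then 1 else if k = j then z else 0"]
        quadratic_form_two[of i w j z A] False ij by (simp only:) simp
    have "A (j, i) = cnj (A (i, j))" using h[of i j] ij by simp
    then show ?thesis
      using ge[of 1] ge[of "-1"] ge[of "\<i>"] ge[of "-\<i>"]
        DM_diag[OF assms, of i] DM_diag[OF assms, of j] ij by (auto simp: abs_le_iff)
  qed
  then show ?thesis using cmod_le[of "A (i, j)"] by linarith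
qed

lemma closed_DM: "closed (DM w)"
proof -
  have eval: "continuous_on UNIV (\<lambda>A :: cmat. A x)" for x
    by simp
  have quad: "continuous_on UNIV (\<lambda>A :: cmat. \<Sum>i<w. \<Sum>j<w. cnj (v i) * A (i, j) * v j)" for v
    by (intro continuous_intros eval)
  have "DM w = {A. \<forall>i j. i < w \<and> j < w \<or> A (i, j) = 0}
      \<inter> {A. \<forall>i j. i < w \<and> j < w \<longrightarrow> A (i, j) = cnj (A (j, i))}
      \<inter> {A. \<forall>v. (\<Sum>i<w. \<Sum>j<w. cnj (v i) * A (i, j) * v j) \<in> \<real>
          \<and> 0 \<le> Re (\<Sum>i<w. \<Sum>j<w. cnj (v i) * A (i, j) * v j)}
      \<inter> {A. (\<Sum>i<w. A (i, i)) = 1}"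
    unfolding DM_def supported_def hermitian_def psd_def trace_def by blast
  moreover have "closed {A :: cmat. \<forall>i j. i < w \<and> j < w \<or> A (i, j) = 0}"
    by (intro closed_Collect_all closed_Collect_disj closed_Collect_const closed_Collect_eq
        eval continuous_on_const)
  moreover have "closed {A :: cmat. \<forall>i j. i < w \<and> j < w \<longrightarrow> A (i, j) = cnj (A (j, i))}"
    by (intro closed_Collect_all closed_Collect_imp open_Collect_const closed_Collect_eq
        eval continuous_on_cnj)
  moreover have "closed {A :: cmat. \<forall>v. (\<Sum>i<w. \<Sum>j<w. cnj (v i) * A (i, j) * v j) \<in> \<real>
          \<and> 0 \<le> Re (\<Sum>i<w. \<Sum>j<w. cnj (v i) * A (i, j) * v j)}"
  proof -
    have "closed {A :: cmat. (\<Sum>i<w. \<Sum>j<w. cnj (v i) * A (i, j) * v j) \<in> \<real>}" for v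
      using closed_vimage[OF closed_complex_Reals quad[of v]] by (simp add: vimage_def)
    then show ?thesis
      by (intro closed_Collect_all closed_Collect_conj closed_Collect_le
          continuous_on_const continuous_on_Re quad)
  qed
  moreover have "closed {A :: cmat. (\<Sum>i<w. A (i, i)) = 1}"
    by (intro closed_Collect_eq continuous_on_const continuous_on_sum eval)
  ultimately show ?thesis by (simp add: closed_Int)
qed

text \<open>The ambient space has infinitely many coordinates, so compactness comes from Tychonoff:
  \<open>DM w\<close> is a closed subset of a product of closed discs.\<close>

lemma compact_DM: "compact (DM w)"
proof -
  have "compact (PiE UNIV (\<lambda>_ :: nat \<times> nat. cball (0 :: complex) 2))"
    using compactin_PiE[of "\<lambda>_. euclidean" "UNIV" "\<lambda>_ :: nat \<times> nat. cball (0 :: complex) 2"]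
    by (simp add: euclidean_product_topology)
  moreover have "DM w \<subseteq> PiE UNIV (\<lambda>_ :: nat \<times> nat. cball (0 :: complex) 2)"
    using DM_bounded by (auto simp: PiE_UNIV_domain)
  ultimately show ?thesis
    using compact_Int_closed[OF _ closed_DM] by (metis inf.absorb2)
qed

lemma DM_mix:
  assumes "A \<in> DM w" "B \<in> DM w" "0 \<le> s" "s \<le> (1::real)"
  shows "(\<lambda>x. of_real (1 - s) * A x + of_real s * B x) \<in> DM w"
proof -
  let ?C = "\<lambda>x. of_real (1 - s) * A x + of_real s * B x"
  have "(\<Sum>i<w. \<Sum>j<w. cnj (v i) * ?C (i, j) * v j)
      = of_real (1 - s) * (\<Sum>i<w. \<Sum>j<w. cnj (v i) * A (i, j) * v j)
        + of_real s * (\<Sum>i<w. \<Sum>j<w. cnj (v i) * B (i, j) * v j)" for v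
    by (simp add: sum_distrib_left sum.distrib[symmetric] algebra_simps)
  then have "psd w ?C"
    using assms unfolding DM_def psd_def by (auto simp del: of_real_diff)
  moreover have "supported w ?C" using assms by (auto simp: DM_def supported_def)
  moreover have "hermitian w ?C"
    using assms by (intro hermitianI) (simp add: DM_def hermitian_cnj[of w])
  moreover have "trace w ?C = of_real (1 - s) * trace w A + of_real s * trace w B"
    by (simp add: trace_def sum.distrib sum_distrib_left)
  ultimately show ?thesis using assms by (simp add: DM_def)
qed

text \<open>By convexity, any two states are joined inside the set by a segment, a continuous image
  of the unit interval.\<close>

lemma connected_DM: "connected (DM w)"
proof (subst connected_iff_connected_component, intro ballI)
  fix A B assume AB: "A \<in> DM w" "B \<in> DM w"
  define f where "f = (\<lambda>(s :: real, X :: cmat, P :: cmat).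
    (\<lambda>x. complex_of_real (1 - s) * X x + of_real s * P x))"
  let ?T = "f ` ({0..1} \<times> {A} \<times> {B})"
  have "connected ?T"
    unfolding f_def
    by (intro connected_continuous_image continuous_on_mix connected_Times) auto
  moreover have "?T \<subseteq> DM w"
    using AB DM_mix unfolding f_def by (auto simp del: of_real_diff)
  moreover have "f (0, A, B) \<in> ?T" "f (1, A, B) \<in> ?T" by (rule imageI; simp)+
  moreover have "f (0, A, B) = A" "f (1, A, B) = B" by (simp_all add: f_def)
  ultimately show "connected_component (DM w) A B"
    unfolding connected_component_def by metis
qed

lemma compact_connected_prodDM: "compact (prodDM ns) \<and> connected (prodDM ns)"
proof (induction ns)
  case Nil
  show ?case by (simp add: prodDM_Nil)
next
  case (Cons n ns)
  then show ?case
    unfolding prodDM_Cons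
    by (simp add: compact_continuous_image connected_continuous_image kron_continuous
        compact_Times connected_Times compact_DM connected_DM)
qed

section \<open>Recursion on the ensemble length\<close>

lemma Sigmak_one: "Sigmak ns (Suc 0) = prodDM ns"
proof (intro equalityI subsetI)
  fix A assume "A \<in> Sigmak ns (Suc 0)"
  then obtain m c P where m: "m \<le> Suc 0" "\<forall>i<m. 0 \<le> c i \<and> P i \<in> prodDM ns"
    "(\<Sum>i<m. c i) = (1::real)" "A = (\<lambda>x. \<Sum>i<m. complex_of_real (c i) * P i x)"
    unfolding Sigmak_def by blast
  then have "m = Suc 0" by (cases m) auto
  then show "A \<in> prodDM ns" using m by simp
next
  fix A assume "A \<in> prodDM ns"
  then show "A \<in> Sigmak ns (Suc 0)"
    by (intro Sigmak_I[of "{0::nat}" _ "\<lambda>_. 1" "\<lambda>_. A"]) auto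
qed

lemma Sigmak_mono: "k \<le> l \<Longrightarrow> Sigmak ns k \<subseteq> Sigmak ns l"
  unfolding Sigmak_def using order_trans by blast

text \<open>Forwards, the last state is split off and the other weights are divided by
  \<open>1 - c l\<close>; backwards, the old weights are multiplied by \<open>1 - s\<close>.
  Positivity of \<open>k\<close> matters since no convex combination has length 0.\<close>

lemma Sigmak_Suc:
  assumes "k > 0"
  shows "Sigmak ns (Suc k) = (\<lambda>(s, X, P) x. complex_of_real (1 - s) * X x + of_real s * P x)
    ` ({0..1} \<times> Sigmak ns k \<times> prodDM ns)" (is "_ = ?f ` ?D")
proof (intro equalityI subsetI)
  fix A assume "A \<in> Sigmak ns (Suc k)"
  then obtain m c P where m: "m \<le> Suc k" "\<And>i. i < m \<Longrightarrow> 0 \<le> c i" "\<And>i. i < m \<Longrightarrow> P i \<in> prodDM ns"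
    "(\<Sum>i<m. c i) = (1::real)" "A = (\<lambda>x. \<Sum>i<m. complex_of_real (c i) * P i x)"
    unfolding Sigmak_def by blast
  then obtain l where [simp]: "m = Suc l" by (cases m) auto
  have le: "l \<le> k" using m(1) by simp
  have Pl: "P l \<in> prodDM ns" using m(3) by simp
  have "P l \<in> Sigmak ns k" using Sigmak_mono[of "Suc 0" k ns] assms Pl by (auto simp: Sigmak_one)
  show "A \<in> ?f ` ?D"
  proof (cases "c l = 1")
    \<comment> \<open>Renormalising would divide by zero here. All other weights vanish, and
      \<open>P l\<close> itself fills the slot for the shorter ensemble.\<close>
    case True
    then have "(\<Sum>i<l. c i) = 0" using m(4) by simp
    then have "c i = 0" if "i < l" for i
      using m(2) that by (subst (asm) sum_nonneg_eq_0_iff) auto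
    then have "A = P l" using m(5) True by simp
    then have "A = ?f (1, P l, P l)" by simp
    moreover have "(1, P l, P l) \<in> ?D" using Pl \<open>P l \<in> Sigmak ns k\<close> by simp
    ultimately show ?thesis by (rule image_eqI)
  next
    case False
    have sum: "(\<Sum>i<l. c i) = 1 - c l" using m(4) by simp
    moreover have "0 \<le> (\<Sum>i<l. c i)" using m(2) by (intro sum_nonneg) auto
    ultimately have lt: "0 < 1 - c l" using False by simp
    define X where "X = (\<lambda>x. \<Sum>i<l. complex_of_real (c i / (1 - c l)) * P i x)"
    have "(\<Sum>i<l. c i / (1 - c l)) = 1"
      using sum lt by (simp add: sum_divide_distrib[symmetric])
    then have "X \<in> Sigmak ns k"
      using m(2,3) le lt by (intro Sigmak_I[of "{..<l}" _ "\<lambda>i. c i / (1 - c l)" P]) (auto simp: X_def)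
    moreover have "A = ?f (c l, X, P l)"
      unfolding m(5) X_def using lt
      by (auto simp: sum_distrib_left simp flip: of_real_diff intro!: ext sum.cong)
    moreover have "(c l, X, P l) \<in> ?D"
      using Pl m(2)[of l] lt \<open>X \<in> Sigmak ns k\<close> by simp
    ultimately show ?thesis by (intro image_eqI)
  qed
next
  fix A assume "A \<in> ?f ` ?D"
  then obtain s X P where A: "A = (\<lambda>x. complex_of_real (1 - s) * X x + of_real s * P x)"
    and s: "0 \<le> s" "s \<le> 1" and "X \<in> Sigmak ns k" and P: "P \<in> prodDM ns" by auto
  then obtain m c Q where m: "m \<le> k" "\<And>i. i < m \<Longrightarrow> 0 \<le> c i" "\<And>i. i < m \<Longrightarrow> Q i \<in> prodDM ns"
    "(\<Sum>i<m. c i) = (1::real)" "X = (\<lambda>x. \<Sum>i<m. complex_of_real (c i) * Q i x)"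
    unfolding Sigmak_def by blast
  show "A \<in> Sigmak ns (Suc k)"
  proof (rule Sigmak_I[of "{..<Suc m}" _ "\<lambda>i. if i = m then s else (1 - s) * c i" "\<lambda>i. if i = m then P else Q i"])
    have "(\<Sum>i<Suc m. if i = m then s else (1 - s) * c i) = (1 - s) * (\<Sum>i<m. c i) + s"
      by (simp add: sum_distrib_left)
    then show "(\<Sum>i<Suc m. if i = m then s else (1 - s) * c i) = 1" using m(4) by simp
    show "A = (\<lambda>x. \<Sum>i<Suc m. complex_of_real (if i = m then s else (1 - s) * c i) * (if i = m then P else Q i) x)"
      unfolding A m(5) by (rule ext) (simp add: sum_distrib_left mult.assoc)
  qed (use m s P in auto)
qed

lemma compact_connected_Sigmak:
  assumes "k > 0"
  shows "compact (Sigmak ns k) \<and> connected (Sigmak ns k)"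
  using assms
proof (induction k rule: nat_induct_non_zero)
  case 1
  then show ?case using compact_connected_prodDM by (simp add: Sigmak_one)
next
  case (Suc k)
  then show ?case
    unfolding Sigmak_Suc[OF Suc(1)] using compact_connected_prodDM[of ns]
    by (intro conjI compact_continuous_image connected_continuous_image continuous_on_mix
        compact_Times connected_Times) auto
qed

text \<open>Being compact, the set is closed and equals its closure, so it can be dense only if it
  is everything.\<close>

lemma Sigmak_part_a:
  assumes "k > 0"
  shows "Sigmak ns k \<subseteq> Sigma ns \<and> connected (Sigmak ns k) \<and> compact (Sigmak ns k) \<and>
          (Sigmak ns k \<noteq> Sigma ns \<longrightarrow>
             \<not> (Sigma ns \<subseteq> closure (Sigmak ns k)) \<and>
             openin (top_of_set (Sigma ns)) (Sigma ns - Sigmak ns k))"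
proof -
  have sub: "Sigmak ns k \<subseteq> Sigma ns" by (auto simp: Sigma_def)
  have "closed (Sigmak ns k)" using compact_connected_Sigmak[OF assms] compact_imp_closed by blast
  moreover from this have "closedin (top_of_set (Sigma ns)) (Sigmak ns k)"
    using sub by (simp add: closed_subset)
  ultimately show ?thesis
    using sub compact_connected_Sigmak[OF assms] by (auto simp: openin_diff)
qed

subsection \<open>Eigenvalues of matrices over a finite index set\<close>

text \<open>Gaussian elimination: a pivot \<open>p\<close> in equation \<open>i\<close> is
  eliminated from the other equations (coefficients \<open>b\<close>), the smaller system is solved
  by induction, and back substitution defines the value of \<open>v\<close> at
  \<open>p\<close>.\<close>

lemma homogeneous_system_nontrivial:
  fixes a :: "'i \<Rightarrow> 'j \<Rightarrow> 'a::field"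
  assumes "finite I" "finite J" "card I < card J"
  shows "\<exists>w. (\<exists>j\<in>J. w j \<noteq> 0) \<and> (\<forall>i\<in>I. (\<Sum>j\<in>J. a i j * w j) = 0)"
  using assms
proof (induction I arbitrary: J a rule: finite_induct)
  case empty
  then have "J \<noteq> {}" by auto
  then show ?case by (intro exI[of _ "\<lambda>_. 1"]) auto
next
  case (insert i I)
  show ?case
  proof (cases "\<forall>j\<in>J. a i j = 0")
    case True
    have "card I < card J" using insert by simp
    then obtain w where "\<exists>j\<in>J. w j \<noteq> 0" "\<forall>i\<in>I. (\<Sum>j\<in>J. a i j * w j) = 0"
      using insert by blast
    then show ?thesis using True by (intro exI[of _ w]) auto
  next
    case False
    then obtain p where p: "p \<in> J" "a i p \<noteq> 0" by blast
    let ?J = "J - {p}"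
    define b where "b = (\<lambda>k j. a k j - a k p / a i p * a i j)"
    have "finite ?J" "card I < card ?J" using insert p by auto
    then obtain w where w: "\<exists>j\<in>?J. w j \<noteq> 0" "\<forall>k\<in>I. (\<Sum>j\<in>?J. b k j * w j) = 0"
      using insert.IH[of ?J b] by blast
    define v where "v = w(p := - (\<Sum>j\<in>?J. a i j * w j) / a i p)"
    have split: "(\<Sum>j\<in>J. a k j * v j) = a k p * v p + (\<Sum>j\<in>?J. a k j * w j)" for k
    proof -
      have "(\<Sum>j\<in>J. a k j * v j) = a k p * v p + (\<Sum>j\<in>?J. a k j * v j)"
        using insert.prems(1) p(1) by (rule sum.remove)
      also have "(\<Sum>j\<in>?J. a k j * v j) = (\<Sum>j\<in>?J. a k j * w j)"
        by (intro sum.cong) (auto simp: v_def)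
      finally show ?thesis .
    qed
    have "(\<Sum>j\<in>J. a i j * v j) = 0" unfolding split using p(2) by (simp add: v_def)
    moreover have "(\<Sum>j\<in>J. a k j * v j) = 0" if "k \<in> I" for k
    proof -
      have "0 = (\<Sum>j\<in>?J. b k j * w j)" using w(2) that by simp
      also have "\<dots> = (\<Sum>j\<in>?J. a k j * w j) - a k p / a i p * (\<Sum>j\<in>?J. a i j * w j)"
        by (simp add: b_def left_diff_distrib sum_subtractf sum_distrib_left mult.assoc)
      finally show ?thesis unfolding split by (simp add: v_def)
    qed
    moreover have "\<exists>j\<in>J. v j \<noteq> 0" using w(1) by (auto simp: v_def)
    ultimately show ?thesis by (intro exI[of _ v]) auto
  qed
qed

text \<open>Applying \<open>L - s\<close> to a linear relation kills the eigenvector for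
  \<open>s\<close> and multiplies each other coefficient by \<open>t - s\<close>, which is nonzero;
  induction then applies.\<close>

lemma eigenvectors_independent:
  fixes L :: "'j \<Rightarrow> 'j \<Rightarrow> 'a::field"
  assumes "finite E"
    and "\<And>t. t \<in> E \<Longrightarrow> \<exists>j\<in>J. u t j \<noteq> 0"
    and "\<And>t j. t \<in> E \<Longrightarrow> j \<in> J \<Longrightarrow> (\<Sum>l\<in>J. L j l * u t l) = t * u t j"
    and "\<And>j. j \<in> J \<Longrightarrow> (\<Sum>t\<in>E. c t * u t j) = 0"
  shows "\<forall>t\<in>E. c t = 0"
  using assms
proof (induction E arbitrary: c rule: finite_induct)
  case empty
  then show ?case by simp
next
  case (insert s E)
  have eq: "(\<Sum>t\<in>E. c t * (t - s) * u t j) = 0" if "j \<in> J" for j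
  proof -
    have "0 = (\<Sum>l\<in>J. L j l * (\<Sum>t\<in>insert s E. c t * u t l))"
      using insert.prems(3) by simp
    also have "\<dots> = (\<Sum>t\<in>insert s E. c t * (\<Sum>l\<in>J. L j l * u t l))"
      unfolding sum_distrib_left by (subst sum.swap) (simp add: mult_ac)
    also have "\<dots> = (\<Sum>t\<in>insert s E. c t * (t * u t j))"
      using insert.prems(2) that by (intro sum.cong) auto
    finally have "(\<Sum>t\<in>insert s E. c t * (t * u t j)) - s * (\<Sum>t\<in>insert s E. c t * u t j) = 0"
      using insert.prems(3)[OF that] by simp
    then show ?thesis
      using insert.hyps by (simp add: sum_distrib_left sum_subtractf[symmetric] algebra_simps)
  qed
  have "\<forall>t\<in>E. c t * (t - s) = 0"
    using insert.prems(1,2) eq by (intro insert.IH) auto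
  then have E: "\<forall>t\<in>E. c t = 0" using insert.hyps by auto
  obtain j where "j \<in> J" "u s j \<noteq> 0" using insert.prems(1) by blast
  then have "c s = 0" using insert.prems(3)[of j] insert.hyps E by simp
  then show ?case using E by simp
qed

text \<open>One more eigenvalue than \<open>card J\<close> would give that many independent
  eigenvectors with only \<open>card J\<close> coordinates, against the existence of a nontrivial
  relation. This replaces determinants.\<close>

lemma finite_eigenvalues:
  fixes L :: "'j \<Rightarrow> 'j \<Rightarrow> 'a::field"
  assumes "finite J"
  shows "finite {t. \<exists>u. (\<exists>j\<in>J. u j \<noteq> 0) \<and> (\<forall>j\<in>J. (\<Sum>l\<in>J. L j l * u l) = t * u j)}"
    (is "finite ?S")
proof (rule ccontr)
  assume "infinite ?S"
  then obtain E where E: "finite E" "card E = Suc (card J)" "E \<subseteq> ?S"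
    using infinite_arbitrarily_large[of ?S "Suc (card J)"] by blast
  have "\<forall>t\<in>E. \<exists>u. (\<exists>j\<in>J. u j \<noteq> 0) \<and> (\<forall>j\<in>J. (\<Sum>l\<in>J. L j l * u l) = t * u j)"
    using E(3) by blast
  from bchoice[OF this] obtain u where u: "\<forall>t\<in>E. (\<exists>j\<in>J. u t j \<noteq> 0)
      \<and> (\<forall>j\<in>J. (\<Sum>l\<in>J. L j l * u t l) = t * u t j)" ..
  obtain c where c: "\<exists>t\<in>E. c t \<noteq> 0" "\<forall>j\<in>J. (\<Sum>t\<in>E. u t j * c t) = 0"
    using homogeneous_system_nontrivial[OF assms E(1), of "\<lambda>j t. u t j", unfolded E(2)] by blast
  have "\<forall>t\<in>E. c t = 0"
    by (rule eigenvectors_independent[OF E(1), of J u L]) (use u c(2) in \<open>auto simp: mult.commute\<close>)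
  then show False using c(1) by blast
qed

subsection \<open>Null sets of the product Lebesgue measure\<close>

text \<open>Compares the product sigma-algebra on extensional functions with the Borel sets of the
  whole function space, so that compact sets become measurable. Coordinates outside \<open>I\<close>
  are constantly \<open>undefined\<close>.\<close>

lemma measurable_PiM_to_borel:
  fixes I :: "'i::countable set"
  shows "(\<lambda>x. x) \<in> borel_measurable (PiM I (\<lambda>_. lborel :: real measure))"
proof (rule measurable_coordinatewise_then_product)
  fix i
  show "(\<lambda>x. x i) \<in> borel_measurable (PiM I (\<lambda>_. lborel :: real measure))"
  proof (cases "i \<in> I")
    case True
    from measurable_component_singleton[OF True, of "\<lambda>_. lborel :: real measure"]
    show ?thesis unfolding measurable_lborel1 .
  next
    case False
    then have "x i = undefined" if "x \<in> space (PiM I (\<lambda>_. lborel :: real measure))" for x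
      using that by (auto simp: space_PiM intro: PiE_arb)
    then have "(\<lambda>x. x i) \<in> borel_measurable (PiM I (\<lambda>_. lborel :: real measure))
      \<longleftrightarrow> (\<lambda>x. undefined :: real) \<in> borel_measurable (PiM I (\<lambda>_. lborel :: real measure))"
      by (rule measurable_cong)
    then show ?thesis by simp
  qed
qed

lemma compact_in_sets_PiM:
  fixes I :: "'i::countable set"
  assumes "compact Z" "Z \<subseteq> extensional I"
  shows "Z \<in> sets (PiM I (\<lambda>_. lborel :: real measure))"
proof -
  have "(\<lambda>x. x) -` Z \<inter> space (PiM I (\<lambda>_. lborel :: real measure)) \<in> sets (PiM I (\<lambda>_. lborel))"
    using assms(1) compact_imp_closed
    by (intro measurable_sets[OF measurable_PiM_to_borel]) (auto intro: borel_closed)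
  moreover have "(\<lambda>x. x) -` Z \<inter> space (PiM I (\<lambda>_. lborel :: real measure)) = Z"
    using assms(2) by (auto simp: space_PiM PiE_def)
  ultimately show ?thesis by simp
qed

lemma emeasure_lborel_vimage_add:
  fixes A :: "real set"
  assumes "A \<in> sets borel"
  shows "emeasure lborel {y. y + c \<in> A} = emeasure lborel A"
proof -
  have "emeasure lborel A = emeasure (distr lborel borel ((+) c)) A"
    by (simp add: lborel_distr_plus)
  also have "\<dots> = emeasure lborel {y. y + c \<in> A}"
    using assms by (subst emeasure_distr) (auto simp: vimage_def add.commute)
  finally show ?thesis by simp
qed

text \<open>The product measure is determined by its values on boxes, where the claim reduces to
  translation invariance in each coordinate.\<close>

lemma PiM_lborel_translation_invariant:
  fixes d :: "'i \<Rightarrow> real"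
  assumes "finite I"
  defines "P \<equiv> PiM I (\<lambda>_. lborel :: real measure)"
  shows "distr P P (\<lambda>x. \<lambda>i\<in>I. x i + d i) = P"
proof -
  interpret product_sigma_finite "\<lambda>_ :: 'i. lborel :: real measure" ..
  have meas: "(\<lambda>x. \<lambda>i\<in>I. x i + d i) \<in> measurable P P"
    unfolding P_def
    by (intro measurable_restrict) (auto intro!: borel_measurable_add
        measurable_component_singleton[where M = "\<lambda>_. lborel :: real measure", unfolded measurable_lborel1])
  show ?thesis
    unfolding P_def
  proof (rule PiM_eqI[OF assms(1)])
    fix A :: "'i \<Rightarrow> real set" assume A: "\<And>i. i \<in> I \<Longrightarrow> A i \<in> sets lborel"
    have AP: "Pi\<^sub>E I A \<in> sets P"
      unfolding P_def using A assms(1) by (intro sets_PiM_I_finite)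
    have shift: "{y. y + d i \<in> A i} \<in> sets lborel" if "i \<in> I" for i
    proof -
      have "(\<lambda>y. y + d i) -` A i \<inter> space lborel \<in> sets lborel"
        using A[OF that] by (intro measurable_sets) auto
      then show ?thesis by (simp add: vimage_def)
    qed
    have "emeasure (distr P P (\<lambda>x. \<lambda>i\<in>I. x i + d i)) (Pi\<^sub>E I A)
        = emeasure P ((\<lambda>x. \<lambda>i\<in>I. x i + d i) -` Pi\<^sub>E I A \<inter> space P)"
      using meas AP by (rule emeasure_distr)
    also have "(\<lambda>x. \<lambda>i\<in>I. x i + d i) -` Pi\<^sub>E I A \<inter> space P = Pi\<^sub>E I (\<lambda>i. {y. y + d i \<in> A i})"
      by (auto simp: P_def space_PiM PiE_iff)
    also have "emeasure P \<dots> = (\<Prod>i\<in>I. emeasure lborel {y. y + d i \<in> A i})"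
      unfolding P_def using shift by (intro emeasure_PiM assms(1))
    also have "\<dots> = (\<Prod>i\<in>I. emeasure lborel (A i))"
      using A by (intro prod.cong refl emeasure_lborel_vimage_add) auto
    finally show "emeasure (distr (PiM I (\<lambda>_. lborel)) (PiM I (\<lambda>_. lborel)) (\<lambda>x. \<lambda>i\<in>I. x i + d i)) (Pi\<^sub>E I A)
        = (\<Prod>i\<in>I. emeasure lborel (A i))"
      unfolding P_def .
  qed simp
qed

text \<open>By Fubini and translation invariance, the integral over \<open>t\<close> of the measure of the translate
  of \<open>Z\<close> by \<open>- t d\<close> is both infinitely many times the measure of \<open>Z\<close> and zero.\<close>

lemma null_set_if_countable_lines:
  fixes d :: "'i \<Rightarrow> real"
  assumes "finite I" and Z: "Z \<in> sets (PiM I (\<lambda>_. lborel :: real measure))"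
    and lines: "\<And>x. x \<in> extensional I \<Longrightarrow> countable {t. (\<lambda>i\<in>I. x i + t * d i) \<in> Z}"
  shows "Z \<in> null_sets (PiM I (\<lambda>_. lborel :: real measure))"
proof -
  define P where "P = PiM I (\<lambda>_. lborel :: real measure)"
  interpret product_sigma_finite "\<lambda>_ :: 'i. lborel :: real measure" ..
  interpret P: sigma_finite_measure P unfolding P_def by (rule sigma_finite[OF assms(1)])
  interpret pair_sigma_finite P "lborel :: real measure" ..
  define \<tau> where "\<tau> = (\<lambda>t x. \<lambda>i\<in>I. x i + t * d i)"
  have \<tau>_pair: "(\<lambda>(x, t). \<tau> t x) \<in> measurable (P \<Otimes>\<^sub>M lborel) P"
    unfolding P_def \<tau>_def by measurable
  have \<tau>_meas: "\<tau> t \<in> measurable P P" for t unfolding P_def \<tau>_def by measurable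
  \<comment> \<open>The slice of \<open>S\<close> at fixed \<open>x\<close> is the set of times at
    which the line through \<open>x\<close> meets \<open>Z\<close>; the slice at fixed
    \<open>t\<close> is a translate of \<open>Z\<close>.\<close>
  define S where "S = (\<lambda>(x, t). \<tau> t x) -` Z \<inter> space (P \<Otimes>\<^sub>M lborel)"
  have S: "S \<in> sets (P \<Otimes>\<^sub>M lborel)"
    unfolding S_def using \<tau>_pair Z by (intro measurable_sets) (auto simp: P_def)
  have "emeasure (P \<Otimes>\<^sub>M lborel) S = (\<integral>\<^sup>+x. emeasure lborel (Pair x -` S) \<partial>P)"
    using S by (rule lborel.emeasure_pair_measure_alt)
  also have "\<dots> = (\<integral>\<^sup>+x. 0 \<partial>P)"
  proof (intro nn_integral_cong)
    fix x assume x: "x \<in> space P"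
    then have "Pair x -` S = {t. (\<lambda>i\<in>I. x i + t * d i) \<in> Z}"
      by (auto simp: S_def \<tau>_def space_pair_measure)
    moreover have "x \<in> extensional I" using x by (auto simp: P_def space_PiM PiE_def)
    ultimately show "emeasure lborel (Pair x -` S) = 0"
      using lines by (simp add: emeasure_lborel_countable)
  qed
  finally have "emeasure (P \<Otimes>\<^sub>M lborel) S = 0" by simp
  moreover have "emeasure (P \<Otimes>\<^sub>M lborel) S = (\<integral>\<^sup>+t. emeasure P ((\<lambda>x. (x, t)) -` S) \<partial>lborel)"
    using S by (rule emeasure_pair_measure_alt2)
  moreover have "emeasure P ((\<lambda>x. (x, t)) -` S) = emeasure P Z" for t
  proof -
    have "(\<lambda>x. (x, t)) -` S = \<tau> t -` Z \<inter> space P"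
      by (auto simp: S_def space_pair_measure)
    also have "emeasure P \<dots> = emeasure (distr P P (\<tau> t)) Z"
      using \<tau>_meas Z by (intro emeasure_distr[symmetric]) (auto simp: P_def)
    also have "distr P P (\<tau> t) = P"
      unfolding \<tau>_def P_def by (rule PiM_lborel_translation_invariant[OF assms(1)])
    finally show ?thesis .
  qed
  ultimately have "emeasure P Z * emeasure lborel (UNIV :: real set) = 0"
    by simp
  then have "emeasure P Z = 0" by simp
  then show ?thesis using Z by (auto simp: P_def)
qed

subsection \<open>Coordinates on the trace-one hermitian matrices\<close>

lemma finite_coord_index: "finite (coord_index w)"
  by (rule finite_subset[of _ "{..<w} \<times> {..<w}"]) (auto simp: coord_index_def)

lemma coord_apply:
  "(i, j) \<in> coord_index w \<Longrightarrow> coord w A (i, j) = (if i \<le> j then Re (A (i, j)) else Im (A (j, i)))"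
  by (simp add: coord_def)

lemma coord_extensional: "coord w A \<in> extensional (coord_index w)"
  by (auto simp: coord_def)

lemma continuous_on_coord: "continuous_on S (coord w)"
proof (rule continuous_on_coordinatewise_then_product)
  fix x :: "nat \<times> nat"
  obtain i j where [simp]: "x = (i, j)" by fastforce
  have eval: "continuous_on S (\<lambda>A :: cmat. A y)" for y
    by (rule continuous_on_subset[OF continuous_on_product_coordinates]) simp
  show "continuous_on S (\<lambda>A. coord w A x)"
  proof (cases "x \<in> coord_index w")
    case True
    then have "coord w A x = (if i \<le> j then Re (A (i, j)) else Im (A (j, i)))" for A
      using coord_apply by simp
    then show ?thesis
      by (cases "i \<le> j") (auto intro!: continuous_on_Re continuous_on_Im eval)
  next
    case False
    then show ?thesis by (simp add: coord_def)
  qed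
qed

lemma tau1_diag_real:
  assumes "A \<in> tau1 w"
  shows "Im (A (i, i)) = 0"
proof (cases "i < w")
  case True
  then have "cnj (A (i, i)) = A (i, i)"
    using assms hermitian_cnj[of w A i i] by (simp add: tau1_def)
  then show ?thesis by (simp add: complex_eq_iff)
next
  case False
  then show ?thesis using assms supportedD[of w A i i] by (simp add: tau1_def)
qed

lemma tau1_last_diag:
  assumes "A \<in> tau1 w" "w > 0"
  shows "A (w - 1, w - 1) = 1 - (\<Sum>i<w - 1. A (i, i))"
proof -
  obtain v where "w = Suc v" using assms(2) by (cases w) auto
  then show ?thesis using assms(1) by (simp add: tau1_def trace_def algebra_simps)
qed

text \<open>The entries that are not coordinates are forced: those below the diagonal and the
  imaginary parts on it by hermiticity, the last diagonal entry by the trace.\<close>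

lemma inj_on_coord_tau1: "inj_on (coord w) (tau1 w)"
proof (rule inj_onI)
  fix A B assume A: "A \<in> tau1 w" and B: "B \<in> tau1 w" and eq: "coord w A = coord w B"
  have c: "(if i \<le> j then Re (A (i, j)) else Im (A (j, i))) = (if i \<le> j then Re (B (i, j)) else Im (B (j, i)))"
    if "i < w" "j < w" "(i, j) \<noteq> (w - 1, w - 1)" for i j
  proof -
    have "(i, j) \<in> coord_index w" using that by (auto simp: coord_index_def)
    then show ?thesis using fun_cong[OF eq, of "(i, j)"] by (simp add: coord_apply)
  qed
  have upper: "A (i, j) = B (i, j)" if "i < j" "j < w" for i j
    using c[of i j] c[of j i] that by (auto simp: complex_eq_iff)
  have diag': "A (i, i) = B (i, i)" if "i < w - 1" for i
    using c[of i i] that tau1_diag_real[OF A, of i] tau1_diag_real[OF B, of i]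
    by (auto simp: complex_eq_iff)
  have diag: "A (i, i) = B (i, i)" if "i < w" for i
  proof (cases "i = w - 1")
    case True
    have "w > 0" using that by simp
    then show ?thesis
      unfolding True using tau1_last_diag[OF A] tau1_last_diag[OF B] diag' by simp
  next
    case False
    then show ?thesis using that diag' by simp
  qed
  have entry: "A (i, j) = B (i, j)" for i j
  proof (cases "i < w \<and> j < w")
    case True
    consider "i < j" | "i = j" | "j < i" by linarith
    then show ?thesis
    proof cases
      case 3
      have "A (i, j) = cnj (A (j, i))" "B (i, j) = cnj (B (j, i))"
        using hermitian_cnj[of w A i j] hermitian_cnj[of w B i j] A B True by (simp_all add: tau1_def)
      then show ?thesis using upper[OF 3] True by simp
    qed (use upper diag True in auto)
  next
    case False
    then show ?thesis using A B supportedD[of w A i j] supportedD[of w B i j] by (simp add: tau1_def)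
  qed
  show "A = B" by (rule ext) (simp add: entry split_paired_all)
qed

text \<open>Inverse of \<open>coord\<close> on \<open>tau1\<close>. A coordinate below the diagonal
  stores the imaginary part of the mirrored entry above it, and the last diagonal entry is restored
  from trace 1.\<close>

definition matrix_of_coord :: "nat \<Rightarrow> (nat \<times> nat \<Rightarrow> real) \<Rightarrow> cmat" where
  "matrix_of_coord w x = (\<lambda>(i, j). if i < w \<and> j < w then
      if i < j then Complex (x (i, j)) (x (j, i))
      else if j < i then Complex (x (j, i)) (- x (i, j))
      else complex_of_real (if i < w - 1 then x (i, i) else 1 - (\<Sum>l<w - 1. x (l, l)))
    else 0)"

lemma matrix_of_coord_tau1:
  assumes "w > 0"
  shows "matrix_of_coord w x \<in> tau1 w"
proof -
  obtain v where v: "w = Suc v" using assms by (cases w) auto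
  have "trace w (matrix_of_coord w x) = 1"
    unfolding trace_def v by (simp add: matrix_of_coord_def)
  moreover have "supported w (matrix_of_coord w x)"
    by (auto simp: supported_def matrix_of_coord_def)
  moreover have "hermitian w (matrix_of_coord w x)"
    by (rule hermitianI) (auto simp: matrix_of_coord_def complex_eq_iff)
  ultimately show ?thesis by (simp add: tau1_def)
qed

lemma coord_matrix_of_coord:
  assumes "x \<in> extensional (coord_index w)"
  shows "coord w (matrix_of_coord w x) = x"
proof (rule ext, clarify)
  fix i j
  show "coord w (matrix_of_coord w x) (i, j) = x (i, j)"
  proof (cases "(i, j) \<in> coord_index w")
    case True
    then have "i < w" "j < w" "i = j \<Longrightarrow> i < w - 1" by (auto simp: coord_index_def)
    then show ?thesis using True by (auto simp: coord_apply matrix_of_coord_def)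
  next
    case False
    then show ?thesis using assms by (auto simp: coord_def extensional_def)
  qed
qed

lemma continuous_on_matrix_of_coord: "continuous_on S (matrix_of_coord w)"
proof (rule continuous_on_coordinatewise_then_product)
  fix p :: "nat \<times> nat"
  obtain i j where [simp]: "p = (i, j)" by fastforce
  have eval: "continuous_on S (\<lambda>x :: nat \<times> nat \<Rightarrow> real. x q)" for q
    by (rule continuous_on_subset[OF continuous_on_product_coordinates]) simp
  show "continuous_on S (\<lambda>x. matrix_of_coord w x p)"
    unfolding matrix_of_coord_def Complex_eq
    by (cases "i < w"; cases "j < w"; cases "i < j"; cases "j < i"; cases "i < w - 1")
      (simp_all, (intro continuous_intros eval)+)
qed

subsection \<open>Short ensembles form a null set\<close>

text \<open>Each term realigns to a rank-one matrix with row factor \<open>A i\<close>. There are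
  fewer than \<open>card J\<close> such factors, so some nonzero \<open>w\<close> is annihilated by
  all of them, hence also by every column of the realigned sum.\<close>

lemma Sigmak_block_dependence:
  assumes "n > 0" "k < (prod_list ms)\<^sup>2" "S \<in> Sigmak (ms @ [n]) k"
  defines "J \<equiv> {..<prod_list ms} \<times> {..<prod_list ms}"
  shows "\<exists>w. (\<exists>p\<in>J. w p \<noteq> 0) \<and>
    (\<forall>c<n. \<forall>d<n. (\<Sum>p\<in>J. S (fst p * n + c, snd p * n + d) * w p) = 0)"
proof -
  obtain m c P where m: "m \<le> k" "\<And>i. i < m \<Longrightarrow> P i \<in> prodDM (ms @ [n])"
    "S = (\<lambda>x. \<Sum>i<m. complex_of_real (c i) * P i x)"
    using assms(3) unfolding Sigmak_def by blast
  have "\<exists>A B. P i = kron n A B" if "i < m" for i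
    using m(2)[OF that] unfolding prodDM_snoc[OF assms(1)] by auto
  then obtain A B where AB: "\<And>i. i < m \<Longrightarrow> P i = kron n (A i) (B i)" by metis
  have "card {..<m} < card J" using m(1) assms(2) by (simp add: J_def power2_eq_square)
  moreover have "finite J" by (simp add: J_def)
  ultimately obtain w where w: "\<exists>p\<in>J. w p \<noteq> 0" "\<forall>i\<in>{..<m}. (\<Sum>p\<in>J. A i p * w p) = 0"
    using homogeneous_system_nontrivial[of "{..<m}" J A] by auto
  have "(\<Sum>p\<in>J. S (fst p * n + e, snd p * n + d) * w p) = 0" if "e < n" "d < n" for e d
  proof -
    have block: "kron n (A i) (B i) (fst p * n + e, snd p * n + d) = A i p * B i (e, d)" for i p
      using kron_block[OF that, of "A i" "B i" "fst p" "snd p"] by simp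
    have "(\<Sum>p\<in>J. S (fst p * n + e, snd p * n + d) * w p)
        = (\<Sum>p\<in>J. \<Sum>i<m. of_real (c i) * B i (e, d) * (A i p * w p))"
      unfolding m(3) sum_distrib_right
      by (intro sum.cong refl) (simp add: AB block)
    also have "\<dots> = (\<Sum>i<m. of_real (c i) * B i (e, d) * (\<Sum>p\<in>J. A i p * w p))"
      by (subst sum.swap) (simp add: sum_distrib_left)
    also have "\<dots> = 0" using w(2) by simp
    finally show ?thesis .
  qed
  then show ?thesis using w(1) by blast
qed

lemma null_set_coord_Sigmak:
  assumes pos: "\<forall>m\<in>set ms. m > 0" and k: "0 < k" "k < (prod_list ms)\<^sup>2"
    and le: "prod_list ms \<le> n" and Z: "compact (Sigmak (ms @ [n]) k)"
  defines "N \<equiv> prod_list (ms @ [n])"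
  shows "coord N ` Sigmak (ms @ [n]) k \<in> null_sets (PiM (coord_index N) (\<lambda>_. lborel))"
proof -
  define M where "M = prod_list ms"
  have "k < M\<^sup>2" using k(2) by (simp add: M_def)
  \<comment> \<open>Since \<open>k\<close> is at least 1, its bound excludes \<open>M = 0\<close>
    and \<open>M = 1\<close>.\<close>
  then have "M \<noteq> 0" "M \<noteq> 1" using k(1) by (metis less_zeroE zero_power2, metis less_one neq0_conv one_power2)
  then have M2: "M \<ge> 2" by simp
  then have n: "n > 0" using le by (simp add: M_def)
  have N: "N = M * n" by (simp add: N_def M_def)
  define J where "J = {..<M} \<times> {..<M}"
  \<comment> \<open>The exceptional weight \<open>1 - M\<close> cancels the \<open>M - 1\<close>
    ones at the other diagonal pairs \<open>(a, a)\<close>, which makes \<open>D\<close> traceless.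
    It is nonzero because \<open>M\<close> is at least 2.\<close>
  define r :: "nat \<times> nat \<Rightarrow> real" where "r = (\<lambda>p. if p = (0, 0) then 1 - real M else 1)"
  have r0: "r p \<noteq> 0" for p using M2 by (simp add: r_def)
  \<comment> \<open>\<open>D\<close> is the sum of \<open>r (a, b)\<close> times \<open>E_ab\<close>
    tensor \<open>E_ab\<close>: its realigned block is diagonal with entries \<open>r\<close>, and
    it is hermitian since \<open>r\<close> is real and symmetric. The second factors fit because
    \<open>M \<le> n\<close>.\<close>
  define D :: cmat where "D = (\<lambda>(i, j). if i < N \<and> j < N \<and> i div n = i mod n \<and> j div n = j mod n
    then of_real (r (i div n, j div n)) else 0)"
  have D_block: "D (a * n + c, b * n + d) = (if a = c \<and> b = d then of_real (r (c, d)) else 0)"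
    if "a < M" "b < M" "c < n" "d < n" for a b c d
    using that mult_add_less_mult[of a M c n] mult_add_less_mult[of b M d n]
    by (simp add: D_def N)
  have "trace N D = (\<Sum>i<M * n. (\<lambda>a c. if a = c then complex_of_real (r (a, a)) else 0) (i div n) (i mod n))"
    unfolding trace_def N by (intro sum.cong) (auto simp: D_def N)
  also have "\<dots> = (\<Sum>a<M. \<Sum>c<n. if a = c then of_real (r (a, a)) else 0)"
    by (rule sum_divmod[OF n])
  also have "\<dots> = (\<Sum>a<M. of_real (r (a, a)))"
    using le by (intro sum.cong refl) (simp add: M_def)
  also have "\<dots> = (\<Sum>a<M. if a = 0 then 1 - of_nat M else 1)"
    by (intro sum.cong) (auto simp: r_def)
  also have "\<dots> = 0"
    using M2 by (subst sum.remove[of _ 0]) (auto simp: of_nat_diff)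
  finally have trD: "trace N D = 0" .
  have add_tau1: "(\<lambda>x. A x + of_real t * D x) \<in> tau1 N" if "A \<in> tau1 N" for A t
  proof -
    have "trace N (\<lambda>x. A x + of_real t * D x) = trace N A + of_real t * trace N D"
      by (simp add: trace_def sum.distrib sum_distrib_left)
    moreover have "supported N (\<lambda>x. A x + of_real t * D x)"
      using that by (auto simp: tau1_def supported_def D_def)
    moreover have "hermitian N (\<lambda>x. A x + of_real t * D x)"
      using that by (intro hermitianI) (auto simp: tau1_def D_def r_def hermitian_cnj[of N])
    ultimately show ?thesis using that trD by (simp add: tau1_def)
  qed
  have coord_add: "coord N (\<lambda>x. A x + of_real t * D x)
      = (\<lambda>i\<in>coord_index N. coord N A i + t * coord N D i)" for A t
    by (rule ext) (auto simp: coord_def restrict_def)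
  have sub: "Sigmak (ms @ [n]) k \<subseteq> tau1 N"
    unfolding N_def using pos n by (intro Sigmak_subset_tau1) auto
  show ?thesis
  proof (rule null_set_if_countable_lines[of _ _ "coord N D"])
    show "finite (coord_index N)" by (rule finite_coord_index)
    show "coord N ` Sigmak (ms @ [n]) k \<in> sets (PiM (coord_index N) (\<lambda>_. lborel))"
      using Z coord_extensional
      by (intro compact_in_sets_PiM compact_continuous_image continuous_on_coord) auto
    fix x :: "nat \<times> nat \<Rightarrow> real" assume x: "x \<in> extensional (coord_index N)"
    let ?T = "{t. (\<lambda>i\<in>coord_index N. x i + t * coord N D i) \<in> coord N ` Sigmak (ms @ [n]) k}"
    show "countable ?T"
    proof (cases "?T = {}")
      case True
      then show ?thesis by simp
    next
      case False
      then obtain t1 S1 where S1: "S1 \<in> Sigmak (ms @ [n]) k"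
        "(\<lambda>i\<in>coord_index N. x i + t1 * coord N D i) = coord N S1" by auto
      \<comment> \<open>Moving back from one known hit gives the hermitian matrix whose coordinates
        are the base point \<open>x\<close> of the line.\<close>
      define A where "A = (\<lambda>x. S1 x + of_real (- t1) * D x)"
      have A: "A \<in> tau1 N" unfolding A_def using S1(1) sub by (intro add_tau1) auto
      have "coord N A = x"
        unfolding A_def coord_add S1(2)[symmetric]
        using x by (auto simp: restrict_def extensional_def)
      \<comment> \<open>Dividing by the diagonal entries of the block of \<open>D\<close> turns
        singularity of the block of \<open>A + t D\<close> into the eigenvalue equation
        \<open>L u = t u\<close>, where \<open>u\<close> is \<open>w\<close> rescaled by
        \<open>r\<close>.\<close>
      define L where "L = (\<lambda>q p. - A (fst p * n + fst q, snd p * n + snd q) / of_real (r p))"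
      let ?E = "{t. \<exists>u. (\<exists>j\<in>J. u j \<noteq> 0) \<and> (\<forall>j\<in>J. (\<Sum>l\<in>J. L j l * u l) = t * u j)}"
      have "?T \<subseteq> complex_of_real -` ?E"
      proof
        fix t assume "t \<in> ?T"
        then obtain S where S: "S \<in> Sigmak (ms @ [n]) k"
          "(\<lambda>i\<in>coord_index N. x i + t * coord N D i) = coord N S" by auto
        have "coord N (\<lambda>x. A x + of_real t * D x) = coord N S"
          unfolding coord_add \<open>coord N A = x\<close> S(2) ..
        then have SA: "(\<lambda>x. A x + of_real t * D x) = S"
          using inj_on_coord_tau1 add_tau1[OF A] S(1) sub by (meson inj_onD subsetD)
        obtain w where w: "\<exists>p\<in>J. w p \<noteq> 0"
          "\<forall>c<n. \<forall>d<n. (\<Sum>p\<in>J. S (fst p * n + c, snd p * n + d) * w p) = 0"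
          using Sigmak_block_dependence[OF n k(2) S(1)] unfolding J_def M_def by blast
        define u where "u = (\<lambda>p. of_real (r p) * w p)"
        have "(\<Sum>p\<in>J. L q p * u p) = of_real t * u q" if "q \<in> J" for q
        proof -
          obtain c d where q: "q = (c, d)" "c < n" "d < n" "c < M" "d < M"
            using \<open>q \<in> J\<close> le unfolding J_def M_def by fastforce
          have "0 = (\<Sum>p\<in>J. S (fst p * n + c, snd p * n + d) * w p)" using w(2) q by simp
          also have "\<dots> = (\<Sum>p\<in>J. A (fst p * n + c, snd p * n + d) * w p)
              + of_real t * (\<Sum>p\<in>J. D (fst p * n + c, snd p * n + d) * w p)"
            unfolding SA[symmetric] by (simp add: sum.distrib sum_distrib_left algebra_simps)
          also have "(\<Sum>p\<in>J. A (fst p * n + c, snd p * n + d) * w p) = - (\<Sum>p\<in>J. L q p * u p)"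
            unfolding sum_negf[symmetric] using r0 by (intro sum.cong) (auto simp: L_def u_def q)
          also have "(\<Sum>p\<in>J. D (fst p * n + c, snd p * n + d) * w p)
              = (\<Sum>p\<in>J. if p = q then u q else 0)"
            using q by (intro sum.cong refl) (auto simp: J_def D_block u_def split: if_splits)
          also have "\<dots> = u q" using that by (simp add: J_def)
          finally show ?thesis by simp
        qed
        moreover have "\<exists>p\<in>J. u p \<noteq> 0" using w(1) r0 by (auto simp: u_def)
        ultimately show "t \<in> complex_of_real -` ?E" by auto
      qed
      moreover have "finite (complex_of_real -` ?E)"
        by (intro finite_vimageI finite_eigenvalues) (auto simp: J_def inj_on_def)
      ultimately show ?thesis using countable_finite finite_subset by blast
    qed
  qed
qed

subsection \<open>Spanning families of product density matrices\<close>

definition matrix_unit :: "nat \<Rightarrow> nat \<Rightarrow> cmat" where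
  "matrix_unit a b = (\<lambda>x. if x = (a, b) then 1 else 0)"

definition lincomb :: "nat \<Rightarrow> (nat \<Rightarrow> cmat) \<Rightarrow> cmat set" where
  "lincomb K P = {X. \<exists>g. X = (\<lambda>x. \<Sum>q<K. g q * P q x)}"

lemma lincombI: "X = (\<lambda>x. \<Sum>q<K. g q * P q x) \<Longrightarrow> X \<in> lincomb K P"
  unfolding lincomb_def by blast

lemma lincomb_member:
  assumes "q < K"
  shows "P q \<in> lincomb K P"
proof (rule lincombI)
  show "P q = (\<lambda>x. \<Sum>r<K. (if q = r then 1 else 0) * P r x)"
    using assms by (simp only: mult_delta_left sum.delta') simp
qed

lemma lincomb_add:
  assumes "X \<in> lincomb K P" "Y \<in> lincomb K P"
  shows "(\<lambda>x. X x + Y x) \<in> lincomb K P"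
proof -
  obtain g h where "X = (\<lambda>x. \<Sum>q<K. g q * P q x)" "Y = (\<lambda>x. \<Sum>q<K. h q * P q x)"
    using assms unfolding lincomb_def by blast
  then show ?thesis
    by (intro lincombI[where g = "\<lambda>q. g q + h q"]) (simp add: sum.distrib distrib_right)
qed

lemma lincomb_scale:
  assumes "X \<in> lincomb K P"
  shows "(\<lambda>x. c * X x) \<in> lincomb K P"
proof -
  obtain g where "X = (\<lambda>x. \<Sum>q<K. g q * P q x)"
    using assms unfolding lincomb_def by blast
  then show ?thesis
    by (intro lincombI[where g = "\<lambda>q. c * g q"]) (simp add: sum_distrib_left mult.assoc)
qed

text \<open>By bilinearity; the pairs of indices are numbered by quotient and remainder modulo
  \<open>L\<close>.\<close>

lemma lincomb_kron:
  assumes "X \<in> lincomb K P" "Y \<in> lincomb L Q" "L > 0"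
  shows "kron n X Y \<in> lincomb (K * L) (\<lambda>q. kron n (P (q div L)) (Q (q mod L)))"
proof -
  obtain g h where X: "X = (\<lambda>x. \<Sum>q<K. g q * P q x)" and Y: "Y = (\<lambda>x. \<Sum>q<L. h q * Q q x)"
    using assms unfolding lincomb_def by blast
  have "kron n X Y (i, j) = (\<Sum>q<K * L. g (q div L) * h (q mod L) * kron n (P (q div L)) (Q (q mod L)) (i, j))"
    for i j
    unfolding kron_apply X Y sum_product
    by (subst sum_divmod[OF assms(3), where f = "\<lambda>q r. g q * h r *
        (P q (i div n, j div n) * Q r (i mod n, j mod n))"]) (simp add: mult_ac)
  then show ?thesis
    by (intro lincombI[where g = "\<lambda>q. g (q div L) * h (q mod L)"]) (auto simp: fun_eq_iff)
qed

text \<open>The quadratic form of this rank-one projector at \<open>u\<close> is the squared modulus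
  of the inner product of \<open>u\<close> and \<open>v\<close>.\<close>

lemma pure_state_DM:
  assumes "\<And>i. i \<ge> n \<Longrightarrow> v i = 0" "(\<Sum>i<n. (cmod (v i))\<^sup>2) = 1"
  shows "(\<lambda>(i, j). v i * cnj (v j)) \<in> DM n"
proof -
  let ?A = "\<lambda>(i, j). v i * cnj (v j)"
  have "(\<Sum>i<n. \<Sum>j<n. cnj (u i) * ?A (i, j) * u j)
      = of_real ((cmod (\<Sum>i<n. cnj (u i) * v i))\<^sup>2)" for u
  proof -
    have "(\<Sum>i<n. \<Sum>j<n. cnj (u i) * ?A (i, j) * u j)
        = (\<Sum>i<n. cnj (u i) * v i) * cnj (\<Sum>i<n. cnj (u i) * v i)"
      unfolding cnj_sum sum_product by (intro sum.cong refl) (simp add: mult_ac)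
    then show ?thesis by (simp only: complex_norm_square)
  qed
  then have "psd n ?A" by (simp add: psd_def del: of_real_power)
  moreover have "supported n ?A" using assms(1) by (auto simp: supported_def)
  moreover have "hermitian n ?A" by (rule hermitianI) simp
  moreover have "trace n ?A = of_real (\<Sum>i<n. (cmod (v i))\<^sup>2)"
    unfolding of_real_sum trace_def by (intro sum.cong) (simp_all only: prod.case complex_norm_square)
  ultimately show ?thesis using assms(2) by (simp add: DM_def)
qed

lemma matrix_unit_DM: "a < n \<Longrightarrow> matrix_unit a a \<in> DM n"
proof -
  assume a: "a < n"
  have "(\<lambda>(i, j). (if i = a then 1 else 0) * cnj (if j = a then 1 else 0)) \<in> DM n"
    using a sum.delta[of "{..<n}" a "\<lambda>_. 1 :: real"]
    by (intro pure_state_DM) (auto simp: if_distrib[of cmod] if_distrib[of "\<lambda>x. x\<^sup>2"] cong: if_cong)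
  also have "(\<lambda>(i, j). (if i = a then 1 else 0) * cnj (if j = a then 1 else 0)) = matrix_unit a a"
    by (auto simp: matrix_unit_def fun_eq_iff)
  finally show ?thesis .
qed

text \<open>The projector onto the span of \<open>e\<^sub>a + z e\<^sub>b\<close> when \<open>z\<close> is a phase.\<close>

definition two_level :: "complex \<Rightarrow> nat \<Rightarrow> nat \<Rightarrow> cmat" where
  "two_level z a b = (\<lambda>x. (matrix_unit a a x + matrix_unit b b x
    + cnj z * matrix_unit a b x + z * matrix_unit b a x) / 2)"

lemma two_level_DM:
  assumes "a < n" "b < n" "a \<noteq> b" "cmod z = 1"
  shows "two_level z a b \<in> DM n"
proof -
  define s where "s = complex_of_real (sqrt (1 / 2))"
  have s: "s * s = 1 / 2" "cmod s * cmod s = 1 / 2" "cnj s = s"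
    unfolding s_def by (simp_all flip: of_real_mult add: real_sqrt_mult[symmetric])
  have zz: "z * cnj z = 1" using complex_norm_square[of z] assms(4) by simp
  \<comment> \<open>The unit vector \<open>(e_a + z e_b) / sqrt 2\<close>.\<close>
  define v where "v = (\<lambda>i. if i = a then s else if i = b then z * s else 0)"
  have "(\<Sum>i<n. (cmod (v i))\<^sup>2) = (\<Sum>i\<in>{a, b}. (cmod (v i))\<^sup>2)"
    using assms by (intro sum.mono_neutral_right) (auto simp: v_def)
  also have "\<dots> = 1" using assms s by (simp add: v_def norm_mult power2_eq_square)
  finally have "(\<lambda>(i, j). v i * cnj (v j)) \<in> DM n"
    using assms by (intro pure_state_DM) (auto simp: v_def)
  moreover have "v i * cnj (v j) = two_level z a b (i, j)" for i j
  proof -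
    have "z * s * cnj (z * s) = (z * cnj z) * (s * s)" "s * cnj (z * s) = cnj z * (s * s)"
      "z * s * cnj s = z * (s * s)" "s * cnj s = s * s"
      by (simp_all add: s(3))
    then have "z * s * cnj (z * s) = 1 / 2" "s * cnj (z * s) = cnj z / 2" "z * s * cnj s = z / 2"
      "s * cnj s = 1 / 2"
      unfolding s(1) zz by simp_all
    then show ?thesis
      using assms(3) by (auto simp: v_def two_level_def matrix_unit_def)
  qed
  ultimately show ?thesis by (simp add: case_prod_unfold)
qed

text \<open>Polarisation: the family consists of the diagonal units and, for each pair
  \<open>a < b\<close>, the two-level states with phases 1 (stored above the diagonal) and \<i>
  (stored below). These two states determine both off-diagonal units modulo diagonal ones.\<close>

lemma DM_spanning_family:
  assumes "n > 0"
  shows "\<exists>P. (\<forall>q<n * n. P q \<in> DM n) \<and> (\<forall>a<n. \<forall>b<n. matrix_unit a b \<in> lincomb (n * n) P)"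
proof -
  define R where "R = (\<lambda>a b. if a = b then matrix_unit a a
    else if a < b then two_level 1 a b else two_level \<i> b a)"
  define P where "P = (\<lambda>q. R (q div n) (q mod n))"
  have "P q \<in> DM n" if "q < n * n" for q
    using that less_divmod[OF assms, of q n] matrix_unit_DM two_level_DM by (auto simp: P_def R_def)
  moreover have R: "R a b \<in> lincomb (n * n) P" if "a < n" "b < n" for a b
    using lincomb_member[of "a * n + b" "n * n" P] that mult_add_less_mult[of a n b n]
    by (simp add: P_def)
  have "matrix_unit a b \<in> lincomb (n * n) P \<and> matrix_unit b a \<in> lincomb (n * n) P"
    if "a < b" "b < n" for a b
  proof -
    have mem: "two_level 1 a b \<in> lincomb (n * n) P" "two_level \<i> a b \<in> lincomb (n * n) P"
      "matrix_unit a a \<in> lincomb (n * n) P" "matrix_unit b b \<in> lincomb (n * n) P"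
      using R[of a b] R[of b a] R[of a a] R[of b b] that by (simp_all add: R_def)
    \<comment> \<open>Here \<open>A\<close>, \<open>B\<close>, \<open>C\<close>, \<open>D\<close>
      stand for the entries of the units at \<open>(a, a)\<close>, \<open>(b, b)\<close>,
      \<open>(a, b)\<close>, \<open>(b, a)\<close>.\<close>
    have "C = (A + B + C + D) / 2 + (\<i> * ((A + B + - \<i> * C + \<i> * D) / 2)
        + ((- (1 + \<i>) / 2) * A + (- (1 + \<i>) / 2) * B))"
      "D = (A + B + C + D) / 2 + (- \<i> * ((A + B + - \<i> * C + \<i> * D) / 2)
        + ((- (1 - \<i>) / 2) * A + (- (1 - \<i>) / 2) * B))" for A B C D :: complex
      by (auto simp: complex_eq_iff field_simps)
    note decompose = this
    have "matrix_unit a b = (\<lambda>x. two_level 1 a b x + (\<i> * two_level \<i> a b x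
        + ((- (1 + \<i>) / 2) * matrix_unit a a x + (- (1 + \<i>) / 2) * matrix_unit b b x)))"
      by (rule ext, unfold two_level_def complex_cnj_one complex_cnj_i mult_1_left, rule decompose(1))
    moreover have "matrix_unit b a = (\<lambda>x. two_level 1 a b x + (- \<i> * two_level \<i> a b x
        + ((- (1 - \<i>) / 2) * matrix_unit a a x + (- (1 - \<i>) / 2) * matrix_unit b b x)))"
      by (rule ext, unfold two_level_def complex_cnj_one complex_cnj_i mult_1_left, rule decompose(2))
    ultimately show ?thesis
      by (simp only:) (intro conjI lincomb_add lincomb_scale mem)
  qed
  moreover have "matrix_unit a a \<in> lincomb (n * n) P" if "a < n" for a
    using R[of a a] that by (simp add: R_def)
  ultimately show ?thesis by (intro exI[of _ P]) (metis nat_neq_iff)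
qed

lemma matrix_unit_kron:
  assumes "n > 0"
  shows "matrix_unit i j = kron n (matrix_unit (i div n) (j div n)) (matrix_unit (i mod n) (j mod n))"
proof (rule ext, clarify)
  fix x y
  have "x = i \<longleftrightarrow> x div n = i div n \<and> x mod n = i mod n"
    "y = j \<longleftrightarrow> y div n = j div n \<and> y mod n = j mod n"
    by (metis div_mult_mod_eq)+
  then show "matrix_unit i j (x, y)
      = kron n (matrix_unit (i div n) (j div n)) (matrix_unit (i mod n) (j mod n)) (x, y)"
    by (auto simp: kron_apply matrix_unit_def)
qed

text \<open>Tensor products of spanning families span, and their sizes multiply to exactly the
  square of the dimension.\<close>

lemma prodDM_spanning_family:
  assumes "\<forall>m\<in>set ms. m > 0"
  shows "\<exists>P. (\<forall>q<(prod_list ms)\<^sup>2. P q \<in> prodDM ms) \<and>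
    (\<forall>a<prod_list ms. \<forall>b<prod_list ms. matrix_unit a b \<in> lincomb ((prod_list ms)\<^sup>2) P)"
  using assms
proof (induction ms)
  case Nil
  have "tensor_list [] = matrix_unit 0 0" by (auto simp: matrix_unit_def fun_eq_iff)
  then show ?case
    using lincomb_member[of 0 1 "\<lambda>_. tensor_list []"]
    by (intro exI[of _ "\<lambda>_. tensor_list []"]) (simp add: prodDM_Nil)
next
  case (Cons n ms)
  let ?M = "prod_list ms"
  have pos: "?M > 0" using Cons.prems by (induction ms) auto
  obtain Q where Q: "\<forall>q<?M\<^sup>2. Q q \<in> prodDM ms"
    "\<forall>a<?M. \<forall>b<?M. matrix_unit a b \<in> lincomb (?M\<^sup>2) Q"
    using Cons by auto
  obtain P where P: "\<forall>q<n * n. P q \<in> DM n" "\<forall>a<n. \<forall>b<n. matrix_unit a b \<in> lincomb (n * n) P"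
    using DM_spanning_family[of n] Cons.prems by auto
  define W where "W = (\<lambda>q. kron ?M (P (q div ?M\<^sup>2)) (Q (q mod ?M\<^sup>2)))"
  have sq: "(prod_list (n # ms))\<^sup>2 = n * n * ?M\<^sup>2" by (simp add: power2_eq_square)
  have pos2: "?M\<^sup>2 > 0" using pos by simp
  have "W q \<in> prodDM (n # ms)" if "q < n * n * ?M\<^sup>2" for q
    using that P(1) Q(1) less_divmod[OF pos2, of q "n * n"] unfolding W_def prodDM_Cons by auto
  moreover have "matrix_unit a b \<in> lincomb (n * n * ?M\<^sup>2) W" if "a < n * ?M" "b < n * ?M" for a b
    unfolding W_def using that pos P(2) Q(2)
    by (subst matrix_unit_kron[OF pos]) (auto intro!: lincomb_kron simp: less_divmod[OF pos])
  ultimately show ?case unfolding sq by (intro exI[of _ W]) simp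
qed

text \<open>The arithmetic-geometric mean inequality bounds the form of the deviation from \<alpha>
  times the identity by \<open>n * \<eta>\<close> times the squared norm of \<open>v\<close>, which
  the scalar part dominates.\<close>

lemma psd_near_scalar:
  assumes "hermitian n B" "real n * \<eta> \<le> \<alpha>"
    and near: "\<And>c d. c < n \<Longrightarrow> d < n \<Longrightarrow> cmod (B (c, d) - (if c = d then of_real \<alpha> else 0)) \<le> \<eta>"
  shows "psd n B"
  unfolding psd_def
proof (intro allI conjI)
  fix v :: "nat \<Rightarrow> complex"
  let ?q = "\<Sum>c<n. \<Sum>d<n. cnj (v c) * B (c, d) * v d"
  have "cnj ?q = (\<Sum>c<n. \<Sum>d<n. v c * B (d, c) * cnj (v d))"
    using assms(1) by (simp add: hermitian_cnj[of n])
  also have "\<dots> = ?q" by (subst sum.swap) (simp add: mult_ac)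
  finally show "?q \<in> \<real>" by (simp add: Reals_cnj_iff)
  define E where "E = (\<lambda>c d. B (c, d) - (if c = d then of_real \<alpha> else 0))"
  let ?e = "\<Sum>c<n. \<Sum>d<n. cnj (v c) * E c d * v d"
  let ?S = "\<Sum>c<n. (cmod (v c))\<^sup>2"
  have "?q = (\<Sum>c<n. \<Sum>d<n. cnj (v c) * (if c = d then of_real \<alpha> else 0) * v d) + ?e"
    by (simp add: E_def sum.distrib[symmetric] algebra_simps)
  also have "(\<Sum>c<n. \<Sum>d<n. cnj (v c) * (if c = d then of_real \<alpha> else 0) * v d) = of_real (\<alpha> * ?S)"
    unfolding of_real_mult of_real_sum sum_distrib_left
    by (intro sum.cong refl) (simp add: mult_delta_left mult_delta_right complex_norm_square mult_ac del: of_real_power)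
  finally have q: "Re ?q = \<alpha> * ?S + Re ?e" by simp
  have "cmod ?e \<le> (\<Sum>c<n. \<Sum>d<n. \<eta> * (((cmod (v c))\<^sup>2 + (cmod (v d))\<^sup>2) / 2))"
  proof (intro order_trans[OF norm_sum] sum_mono)
    fix c d assume cd: "c \<in> {..<n}" "d \<in> {..<n}"
    then have E: "cmod (E c d) \<le> \<eta>" using near by (simp add: E_def)
    then have \<eta>: "0 \<le> \<eta>" using norm_ge_zero order_trans by blast
    have "cmod (cnj (v c) * E c d * v d) = cmod (E c d) * (cmod (v c) * cmod (v d))"
      by (simp add: norm_mult)
    also have "\<dots> \<le> \<eta> * (((cmod (v c))\<^sup>2 + (cmod (v d))\<^sup>2) / 2)"
      using sum_squares_bound[of "cmod (v c)" "cmod (v d)"]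
      by (intro mult_mono E \<eta>) auto
    finally show "cmod (cnj (v c) * E c d * v d) \<le> \<eta> * (((cmod (v c))\<^sup>2 + (cmod (v d))\<^sup>2) / 2)" .
  qed
  also have "\<dots> = \<eta> * (real n * ?S)"
    by (simp add: sum_distrib_left[symmetric] sum_divide_distrib[symmetric] sum.distrib
        mult.commute)
  finally have "\<bar>Re ?e\<bar> \<le> (real n * \<eta>) * ?S"
    using abs_Re_le_cmod[of ?e] by (simp add: mult_ac)
  also have "\<dots> \<le> \<alpha> * ?S" using assms(2) by (intro mult_right_mono sum_nonneg) auto
  finally show "0 \<le> Re ?q" unfolding q by linarith
qed

subsection \<open>Long ensembles contain an open set\<close>

text \<open>Expanding \<open>D\<close> in matrix units on the first factor gives \<open>D = \<Sum>\<^sub>q P\<^sub>q \<otimes> X\<^sub>q\<close>;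
  replacing \<open>X\<^sub>q\<close> by its hermitian part preserves this because \<open>D\<close> and all \<open>P\<^sub>q\<close> are hermitian.\<close>

lemma hermitian_kron_expansion:
  fixes K :: nat
  assumes n: "n > 0" and P: "\<And>q. q < K \<Longrightarrow> P q \<in> tau1 M"
    and g: "\<And>a b x. a < M \<Longrightarrow> b < M \<Longrightarrow> (\<Sum>q<K. g q (a, b) * P q x) = matrix_unit a b x"
    and D: "supported (M * n) D" "hermitian (M * n) D"
    and small: "\<And>i j. i < M * n \<Longrightarrow> j < M * n \<Longrightarrow> cmod (D (i, j)) \<le> \<epsilon>"
  defines "G \<equiv> \<Sum>q<K. \<Sum>a<M. \<Sum>b<M. cmod (g q (a, b))"
  shows "\<exists>Y. (\<forall>q<K. supported n (Y q) \<and> hermitian n (Y q)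
      \<and> (\<forall>c<n. \<forall>d<n. cmod (Y q (c, d)) \<le> G * \<epsilon>))
    \<and> D = (\<lambda>x. \<Sum>q<K. kron n (P q) (Y q) x)"
proof -
  \<comment> \<open>Writing \<open>D\<close> as the sum of \<open>E_ab\<close> tensor its block at
    \<open>(a, b)\<close> and expanding \<open>E_ab\<close> in the \<open>P q\<close> with
    coefficients \<open>g q (a, b)\<close> makes \<open>X q\<close> the factor paired with
    \<open>P q\<close>.\<close>
  define X where "X = (\<lambda>q (c, d). if c < n \<and> d < n
    then \<Sum>a<M. \<Sum>b<M. g q (a, b) * D (a * n + c, b * n + d) else 0)"
  define Y where "Y = (\<lambda>q (c, d). (X q (c, d) + cnj (X q (d, c))) / 2)"
  have X_le: "cmod (X q (c, d)) \<le> G * \<epsilon>" if "q < K" "c < n" "d < n" for q c d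
  proof -
    have "cmod (X q (c, d)) \<le> (\<Sum>a<M. \<Sum>b<M. cmod (g q (a, b)) * \<epsilon>)"
      unfolding X_def using that
      by (auto intro!: sum_norm_le mult_left_mono small mult_add_less_mult simp: norm_mult)
    also have "\<dots> = (\<Sum>a<M. \<Sum>b<M. cmod (g q (a, b))) * \<epsilon>"
      by (simp only: sum_distrib_right)
    also have "\<dots> \<le> G * \<epsilon>"
    \<comment> \<open>Nonnegativity of \<epsilon> is read off from an existing entry of
      \<open>D\<close>; for \<open>M = 0\<close> there is none, but both sides are 0.\<close>
    proof (cases "M = 0")
      case False
      then have "cmod (D (0, 0)) \<le> \<epsilon>" using n by (intro small) auto
      then have "0 \<le> \<epsilon>" using norm_ge_zero order_trans by blast
      moreover have "(\<Sum>a<M. \<Sum>b<M. cmod (g q (a, b))) \<le> G"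
        unfolding G_def using that
        by (intro member_le_sum[of q _ "\<lambda>q. \<Sum>a<M. \<Sum>b<M. cmod (g q (a, b))"]) (auto intro!: sum_nonneg)
      ultimately show ?thesis by (rule mult_right_mono[rotated])
    qed (simp add: G_def)
    finally show ?thesis .
  qed
  have "supported n (Y q)" for q by (auto simp: supported_def Y_def X_def)
  moreover have "hermitian n (Y q)" for q by (rule hermitianI) (simp add: Y_def add.commute)
  moreover have "cmod (Y q (c, d)) \<le> G * \<epsilon>" if "q < K" "c < n" "d < n" for q c d
  proof -
    have "cmod (Y q (c, d)) \<le> (cmod (X q (c, d)) + cmod (X q (d, c))) / 2"
      using norm_triangle_ineq[of "X q (c, d)" "cnj (X q (d, c))"]
      by (simp add: Y_def norm_divide)
    also have "\<dots> \<le> (G * \<epsilon> + G * \<epsilon>) / 2"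
      using X_le[OF that] X_le[OF that(1,3,2)] by (intro divide_right_mono add_mono) auto
    finally show ?thesis by simp
  qed
  moreover have "D x = (\<Sum>q<K. kron n (P q) (Y q) x)" for x
  proof -
    obtain i j where x: "x = (i, j)" by fastforce
    show ?thesis
    proof (cases "i < M * n \<and> j < M * n")
      case False
      have "kron n (P q) (Y q) (i, j) = 0" if "q < K" for q
        using P[OF that] False n supportedD[of M "P q" "i div n" "j div n"]
        by (auto simp: kron_apply tau1_def less_divmod)
      then show ?thesis using supportedD[OF D(1)] False x by simp
    next
      case True
      have expand: "(\<Sum>q<K. P q (i div n, j div n) * X q (i mod n, j mod n)) = D (i, j)"
        if "i < M * n" "j < M * n" for i j
      proof -
        have dm: "i div n < M" "j div n < M" "i mod n < n" "j mod n < n"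
          using that n by (simp_all add: less_divmod)
        have "(\<Sum>q<K. P q (i div n, j div n) * X q (i mod n, j mod n))
            = (\<Sum>q<K. \<Sum>a<M. \<Sum>b<M. D (a * n + i mod n, b * n + j mod n)
                * (g q (a, b) * P q (i div n, j div n)))"
          using dm by (simp add: X_def sum_distrib_left mult_ac)
        also have "\<dots> = (\<Sum>a<M. \<Sum>q<K. \<Sum>b<M. D (a * n + i mod n, b * n + j mod n)
                * (g q (a, b) * P q (i div n, j div n)))"
          by (rule sum.swap)
        also have "\<dots> = (\<Sum>a<M. \<Sum>b<M. \<Sum>q<K. D (a * n + i mod n, b * n + j mod n)
                * (g q (a, b) * P q (i div n, j div n)))"
          by (intro sum.cong refl sum.swap)
        also have "\<dots> = (\<Sum>a<M. \<Sum>b<M. D (a * n + i mod n, b * n + j mod n)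
                * matrix_unit a b (i div n, j div n))"
          by (simp add: sum_distrib_left[symmetric] g)
        also have "\<dots> = (\<Sum>a<M. if a = i div n then D (a * n + i mod n, j div n * n + j mod n) else 0)"
        proof (intro sum.cong refl)
          fix a
          show "(\<Sum>b<M. D (a * n + i mod n, b * n + j mod n) * matrix_unit a b (i div n, j div n))
            = (if a = i div n then D (a * n + i mod n, j div n * n + j mod n) else 0)"
            using dm by (auto simp: matrix_unit_def mult_delta_right)
        qed
        also have "\<dots> = D (i, j)" using dm by simp
        finally show ?thesis .
      qed
      have Pcnj: "P q (i div n, j div n) = cnj (P q (j div n, i div n))" if "q < K" for q
        using P[OF that] True n hermitian_cnj[of M "P q" "i div n" "j div n"]
        by (simp add: tau1_def less_divmod)
      have "(\<Sum>q<K. kron n (P q) (Y q) (i, j))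
          = ((\<Sum>q<K. P q (i div n, j div n) * X q (i mod n, j mod n))
            + (\<Sum>q<K. P q (i div n, j div n) * cnj (X q (j mod n, i mod n)))) / 2"
        by (simp add: kron_apply Y_def sum.distrib[symmetric] sum_divide_distrib distrib_left)
      also have "(\<Sum>q<K. P q (i div n, j div n) * cnj (X q (j mod n, i mod n)))
          = (\<Sum>q<K. cnj (P q (j div n, i div n) * X q (j mod n, i mod n)))"
        by (intro sum.cong refl) (simp add: Pcnj)
      also have "\<dots> = cnj (D (j, i))"
        unfolding cnj_sum[symmetric] using True by (simp add: expand)
      also have "\<dots> = D (i, j)" using hermitian_cnj[OF D(2)] True by blast
      finally show ?thesis using expand True x by simp
    qed
  qed
  ultimately show ?thesis by (intro exI[of _ Y]) (auto simp: fun_eq_iff)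
qed

lemma kron_sum_tau1:
  fixes K :: nat
  assumes n: "n > 0" and P: "\<And>q. q < K \<Longrightarrow> P q \<in> tau1 M"
    and B: "\<And>q. q < K \<Longrightarrow> supported n (B q) \<and> hermitian n (B q)"
  defines "T \<equiv> (\<lambda>x. \<Sum>q<K. kron n (P q) (B q) x)"
  shows "supported (M * n) T \<and> hermitian (M * n) T \<and> trace (M * n) T = (\<Sum>q<K. trace n (B q))"
proof (intro conjI)
  have P': "supported M (P q)" "hermitian M (P q)" "trace M (P q) = 1" if "q < K" for q
    using P[OF that] by (auto simp: tau1_def)
  show "supported (M * n) T"
    using supported_kron[OF P'(1) _ n] B unfolding T_def supported_def by simp
  show "hermitian (M * n) T"
    using hermitian_cnj[OF hermitian_kron[OF P'(2) _ n]] B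
    by (intro hermitianI) (simp add: T_def)
  have "trace (M * n) T = (\<Sum>q<K. trace (M * n) (kron n (P q) (B q)))"
    unfolding trace_def T_def by (rule sum.swap)
  also have "\<dots> = (\<Sum>q<K. trace n (B q))" using P' by (simp add: trace_kron[OF n])
  finally show "trace (M * n) T = (\<Sum>q<K. trace n (B q))" .
qed

lemma Sigmak_contains_open:
  assumes pos: "\<forall>m\<in>set ms. m > 0" and n: "n > 0" and k: "(prod_list ms)\<^sup>2 \<le> k"
  defines "N \<equiv> prod_list (ms @ [n])"
  shows "\<exists>V. open V \<and> tau1 N \<inter> V \<noteq> {} \<and> tau1 N \<inter> V \<subseteq> Sigmak (ms @ [n]) k"
proof -
  define M where "M = prod_list ms"
  define K where "K = M\<^sup>2"
  have M: "M > 0" using pos unfolding M_def by (induction ms) auto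
  then have K: "K > 0" by (simp add: K_def)
  have N: "N = M * n" by (simp add: N_def M_def)
  obtain P where P: "\<forall>q<K. P q \<in> prodDM ms" "\<forall>a<M. \<forall>b<M. matrix_unit a b \<in> lincomb K P"
    using prodDM_spanning_family[OF pos] unfolding M_def K_def by blast
  have "\<forall>p. \<exists>h. fst p < M \<and> snd p < M \<longrightarrow> matrix_unit (fst p) (snd p) = (\<lambda>x. \<Sum>q<K. h q * P q x)"
    using P(2) unfolding lincomb_def by blast
  then obtain h where h: "\<And>p. fst p < M \<Longrightarrow> snd p < M \<Longrightarrow>
      matrix_unit (fst p) (snd p) = (\<lambda>x. \<Sum>q<K. h p q * P q x)" by metis
  define g where "g = (\<lambda>q p. h p q)"
  have g: "(\<Sum>q<K. g q (a, b) * P q x) = matrix_unit a b x" if "a < M" "b < M" for a b x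
    using h[of "(a, b)"] that by (simp add: g_def)
  have Pt: "P q \<in> tau1 M" if "q < K" for q
    using P(1) that prodDM_subset_tau1[OF pos] by (auto simp: M_def)
  \<comment> \<open>Normalises the total trace of \<open>K\<close> copies of \<alpha> times the
    identity of size \<open>n\<close> to 1.\<close>
  define \<alpha> where "\<alpha> = 1 / (real n * real K)"
  have \<alpha>: "\<alpha> > 0" using n K by (simp add: \<alpha>_def)
  define B where "B = (\<lambda>(c, d). if c = d \<and> c < n then complex_of_real \<alpha> else 0)"
  define T0 where "T0 = (\<lambda>x. \<Sum>q<K. kron n (P q) B x)"
  define G where "G = (\<Sum>q<K. \<Sum>a<M. \<Sum>b<M. cmod (g q (a, b)))"
  have G: "G \<ge> 0" unfolding G_def by (intro sum_nonneg) auto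
  \<comment> \<open>Small enough that \<open>n * G * \<epsilon>\<close> stays below \<alpha>, as
    \<open>psd_near_scalar\<close> requires; adding 1 to \<open>G\<close> keeps the denominator
    positive.\<close>
  define \<epsilon> where "\<epsilon> = \<alpha> / (real n * (G + 1))"
  have \<epsilon>: "\<epsilon> > 0" using \<alpha> G n by (simp add: \<epsilon>_def)
  have nG: "real n * (G * \<epsilon>) < \<alpha>"
  proof -
    have "real n * (G * \<epsilon>) = \<alpha> * (G / (G + 1))" using n by (simp add: \<epsilon>_def)
    also have "\<dots> < \<alpha> * 1" using \<alpha> G by (intro mult_strict_left_mono) auto
    finally show ?thesis by simp
  qed
  have Ge: "G * \<epsilon> < \<alpha>"
  proof -
    have "G * \<epsilon> \<le> real n * (G * \<epsilon>)" using n G \<epsilon> mult_right_mono[of 1 "real n" "G * \<epsilon>"] by simp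
    then show ?thesis using nG by simp
  qed
  have Bsh: "supported n B" "hermitian n B"
    by (auto simp: B_def supported_def intro!: hermitianI)
  have "trace n B = of_nat n * of_real \<alpha>" by (simp add: trace_def B_def)
  then have "(\<Sum>q<K. trace n B) = 1" using n K by (simp add: \<alpha>_def)
  then have T0: "T0 \<in> tau1 N"
    using kron_sum_tau1[of n K P M "\<lambda>_. B"] n Pt Bsh by (simp add: tau1_def N T0_def)
  \<comment> \<open>Only finitely many entries are constrained, so \<open>V\<close> is open in the
    product topology.\<close>
  define V where "V = (\<Inter>p\<in>{..<N} \<times> {..<N}. {T. cmod (T p - T0 p) < \<epsilon>})"
  have "open V"
    unfolding V_def by (intro open_INT ballI open_Collect_less continuous_intros) auto
  moreover have "T0 \<in> tau1 N \<inter> V" using T0 \<epsilon> by (auto simp: V_def)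
  moreover have "T \<in> Sigmak (ms @ [n]) k" if T: "T \<in> tau1 N \<inter> V" for T
  proof -
    define D where "D = (\<lambda>x. T x - T0 x)"
    have "supported (M * n) D" using T T0 by (auto simp: D_def tau1_def supported_def N)
    moreover have "hermitian (M * n) D"
      using T T0 by (intro hermitianI) (auto simp: D_def tau1_def hermitian_cnj[of N] N[symmetric])
    moreover have "cmod (D (i, j)) \<le> \<epsilon>" if "i < M * n" "j < M * n" for i j
      using T that by (auto simp: V_def D_def N intro: less_imp_le)
    ultimately obtain Y where Y: "\<forall>q<K. supported n (Y q) \<and> hermitian n (Y q)
        \<and> (\<forall>c<n. \<forall>d<n. cmod (Y q (c, d)) \<le> G * \<epsilon>)" "D = (\<lambda>x. \<Sum>q<K. kron n (P q) (Y q) x)"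
      using hermitian_kron_expansion[OF n Pt g, of D \<epsilon>] unfolding G_def by blast
    \<comment> \<open>The unnormalised second factors. Their traces \<open>c q\<close> become the
      weights of the ensemble, and positivity of these allows the normalisation to states
      \<open>\<rho> q\<close>.\<close>
    define C where "C = (\<lambda>q x. B x + Y q x)"
    have Csupp: "supported n (C q)" if "q < K" for q
      using Y(1) that Bsh by (auto simp: C_def supported_def)
    have Cherm: "hermitian n (C q)" if "q < K" for q
      using Y(1) that Bsh by (intro hermitianI) (auto simp: C_def hermitian_cnj[of n])
    have Cpsd: "psd n (C q)" if "q < K" for q
      using nG Y(1) that by (intro psd_near_scalar[OF Cherm[OF that], of "G * \<epsilon>" \<alpha>]) (auto simp: C_def B_def)
    define c where "c = (\<lambda>q. Re (trace n (C q)))"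
    have trC: "trace n (C q) = of_real (c q)" if "q < K" for q
    proof -
      have "cnj (trace n (C q)) = trace n (C q)"
        using hermitian_cnj[OF Cherm[OF that]] by (simp add: trace_def)
      then show ?thesis by (simp add: c_def complex_eq_iff)
    qed
    have cpos: "c q > 0" if "q < K" for q
    proof -
      have "Re (C q (d, d)) > 0" if "d < n" for d
      proof -
        have "\<bar>Re (Y q (d, d))\<bar> \<le> G * \<epsilon>"
          using Y(1) \<open>q < K\<close> that abs_Re_le_cmod order_trans by blast
        then show ?thesis using Ge that by (simp add: C_def B_def)
      qed
      then show ?thesis unfolding c_def trace_def using n by (auto intro!: sum_pos)
    qed
    define \<rho> where "\<rho> = (\<lambda>q x. C q x / of_real (c q))"
    have "\<rho> q \<in> DM n" if "q < K" for q
    proof -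
      have "trace n (\<rho> q) = trace n (C q) / of_real (c q)"
        by (simp add: trace_def \<rho>_def sum_divide_distrib)
      then have "trace n (\<rho> q) = 1" using trC[OF that] cpos[OF that] by simp
      moreover have "supported n (\<rho> q)" using Csupp[OF that] by (simp add: supported_def \<rho>_def)
      moreover have "hermitian n (\<rho> q)"
        using hermitian_cnj[OF Cherm[OF that]] by (intro hermitianI) (simp add: \<rho>_def)
      moreover have "psd n (\<rho> q)"
      proof -
        have "(\<Sum>i<n. \<Sum>j<n. cnj (v i) * \<rho> q (i, j) * v j)
            = (\<Sum>i<n. \<Sum>j<n. cnj (v i) * C q (i, j) * v j) / of_real (c q)" for v
          by (simp add: \<rho>_def sum_divide_distrib)
        then show ?thesis
          using Cpsd[OF that] cpos[OF that] unfolding psd_def by (simp add: Reals_divide)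
      qed
      ultimately show ?thesis by (simp add: DM_def)
    qed
    then have prod: "kron n (P q) (\<rho> q) \<in> prodDM (ms @ [n])" if "q < K" for q
      using P(1) that unfolding prodDM_snoc[OF n] by auto
    have T_C: "T = (\<lambda>x. \<Sum>q<K. kron n (P q) (C q) x)"
    proof
      fix x
      have "T x = T0 x + D x" by (simp add: D_def)
      also have "\<dots> = (\<Sum>q<K. kron n (P q) (C q) x)"
        unfolding T0_def Y(2) sum.distrib[symmetric]
        by (cases x) (simp add: kron_apply C_def distrib_left)
      finally show "T x = (\<Sum>q<K. kron n (P q) (C q) x)" .
    qed
    have "(\<Sum>q<K. trace n (C q)) = trace N T"
      unfolding T_C N using kron_sum_tau1[of n K P M C] n Pt Csupp Cherm by simp
    also have "\<dots> = 1" using T by (simp add: tau1_def)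
    also have "(\<Sum>q<K. trace n (C q)) = of_real (\<Sum>q<K. c q)" by (simp add: trC)
    finally have "(\<Sum>q<K. c q) = 1" by (simp only: of_real_eq_1_iff)
    moreover have "T = (\<lambda>x. \<Sum>q<K. of_real (c q) * kron n (P q) (\<rho> q) x)"
    proof
      fix x
      have "c q \<noteq> 0" if "q < K" for q using cpos[OF that] by simp
      then show "T x = (\<Sum>q<K. of_real (c q) * kron n (P q) (\<rho> q) x)"
        unfolding T_C by (cases x) (simp add: kron_apply \<rho>_def)
    qed
    ultimately show ?thesis
      using k prod cpos
      by (intro Sigmak_I[of "{..<K}" _ c "\<lambda>q. kron n (P q) (\<rho> q)"])
        (auto simp: K_def M_def intro: less_imp_le)
  qed
  ultimately show ?thesis by blast
qed

section \<open>Positive measure from a relatively open subset\<close>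

lemma emeasure_lborel_open_neq_0:
  fixes X :: "real set"
  assumes "open X" "x \<in> X"
  shows "emeasure lborel X \<noteq> 0"
proof -
  obtain e where e: "e > 0" "ball x e \<subseteq> X" using assms open_contains_ball by blast
  have "ball x e = {x - e<..<x + e}" by (auto simp: dist_real_def)
  then have "emeasure lborel (ball x e) = ennreal (2 * e)" using e by simp
  also have "\<dots> > 0" using e by simp
  finally have "0 < emeasure lborel (ball x e)" .
  also have "\<dots> \<le> emeasure lborel X" using e(2) assms(1) by (intro emeasure_mono) auto
  finally show ?thesis by simp
qed

text \<open>The preimage of \<open>V\<close> under the inverse chart is open, so it contains a basic
  open box around \<open>coord w T\<close>; the part of this box over \<open>coord_index w\<close>
  lies in the image of \<open>S\<close> and has a product of positive lengths as its
  measure.\<close>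

lemma emeasure_coord_pos:
  assumes "w > 0" "compact S" "open V" "tau1 w \<inter> V \<noteq> {}" "tau1 w \<inter> V \<subseteq> S"
  shows "0 < emeasure (leb_tau w) (coord w ` S)"
proof -
  let ?P = "PiM (coord_index w) (\<lambda>_. lborel :: real measure)"
  interpret product_sigma_finite "\<lambda>_ :: nat \<times> nat. lborel :: real measure" ..
  obtain T where T: "T \<in> tau1 w" "T \<in> V" using assms(4) by blast
  have "matrix_of_coord w (coord w T) = T"
    using inj_on_coord_tau1[of w] matrix_of_coord_tau1[OF assms(1)] T(1)
      coord_matrix_of_coord[OF coord_extensional] by (auto dest: inj_onD)
  then have mem: "coord w T \<in> matrix_of_coord w -` V" using T(2) by simp
  have "open (matrix_of_coord w -` V)"
    using assms(3) continuous_on_matrix_of_coord by (rule open_vimage)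
  then have "openin (product_topology (\<lambda>_. euclidean) UNIV) (matrix_of_coord w -` V)"
    by (simp add: euclidean_product_topology)
  from product_topology_open_contains_basis[OF this mem]
  obtain X where X: "coord w T \<in> Pi\<^sub>E UNIV X" "\<And>i. open (X i)"
    "Pi\<^sub>E UNIV X \<subseteq> matrix_of_coord w -` V" by auto
  have Xm: "coord w T i \<in> X i" for i using X(1) unfolding PiE_iff by blast
  have "Pi\<^sub>E (coord_index w) X \<subseteq> coord w ` S"
  proof
    fix x assume x: "x \<in> Pi\<^sub>E (coord_index w) X"
    \<comment> \<open>Outside the index set both \<open>x\<close> and \<open>coord w T\<close> equal
      \<open>undefined\<close>, so the unrestricted box condition holds there too.\<close>
    have "x i \<in> X i" for i
    proof (cases "i \<in> coord_index w")
      case False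
      then have "x i = coord w T i"
        using x coord_extensional[of w T] by (cases i) (simp add: PiE_iff extensional_def)
      then show ?thesis using Xm by simp
    qed (use x in \<open>auto simp: PiE_iff\<close>)
    then have "x \<in> Pi\<^sub>E UNIV X" by (simp only: PiE_UNIV_domain Pi_iff) simp
    then have "matrix_of_coord w x \<in> V" using X(3) by blast
    then have "matrix_of_coord w x \<in> S" using matrix_of_coord_tau1[OF assms(1)] assms(5) by blast
    moreover have "coord w (matrix_of_coord w x) = x"
      using x by (intro coord_matrix_of_coord) (auto simp: PiE_iff)
    ultimately show "x \<in> coord w ` S" by (metis imageI)
  qed
  moreover have S: "coord w ` S \<in> sets ?P"
    using assms(2) coord_extensional
    by (intro compact_in_sets_PiM compact_continuous_image continuous_on_coord) auto
  ultimately have "emeasure ?P (Pi\<^sub>E (coord_index w) X) \<le> emeasure ?P (coord w ` S)"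
    by (intro emeasure_mono)
  moreover have "emeasure ?P (Pi\<^sub>E (coord_index w) X) = (\<Prod>i\<in>coord_index w. emeasure lborel (X i))"
    using X(2) by (intro emeasure_PiM finite_coord_index) auto
  moreover have "\<dots> \<noteq> 0"
    using emeasure_lborel_open_neq_0[OF X(2) Xm] finite_coord_index by (simp add: prod_zero_iff)
  ultimately have "0 < emeasure ?P (coord w ` S)" by (metis not_gr_zero le_zero_eq)
  \<comment> \<open>The image is already measurable before completion, so completing the measure
    leaves its value unchanged.\<close>
  then show ?thesis using S by (simp add: leb_tau_def)
qed

theorem theorem1:
  fixes ns :: "nat list" and k :: nat
  assumes "length ns \<ge> 1"
    and "\<forall>i<length ns. ns ! i > 0"
    and "sorted ns"
    and "prod_list (butlast ns) \<le> last ns"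
    and "k > 0"
  defines "N \<equiv> prod_list ns"
  shows "(Sigmak ns k \<subseteq> Sigma ns \<and> connected (Sigmak ns k) \<and> compact (Sigmak ns k) \<and>
          (Sigmak ns k \<noteq> Sigma ns \<longrightarrow>
             \<not> (Sigma ns \<subseteq> closure (Sigmak ns k)) \<and>
             openin (top_of_set (Sigma ns)) (Sigma ns - Sigmak ns k)))
       \<and> (k < (prod_list (butlast ns))\<^sup>2 \<longrightarrow>
             coord N ` Sigmak ns k \<in> null_sets (leb_tau N))
       \<and> (k \<ge> (prod_list (butlast ns))\<^sup>2 \<longrightarrow>
             emeasure (leb_tau N) (coord N ` Sigmak ns k) > 0 \<and>
             (\<exists>U. U \<noteq> {} \<and> U \<subseteq> Sigmak ns k \<and> openin (top_of_set (tau1 N)) U))"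
proof (intro conjI[OF Sigmak_part_a[OF \<open>k > 0\<close>]] conjI impI)
  define ms n where "ms = butlast ns" and "n = last ns"
  have ns: "ns = ms @ [n]" using assms(1) by (cases ns rule: rev_cases) (auto simp: ms_def n_def)
  have "\<forall>m\<in>set ns. m > 0" using assms(2) by (metis in_set_conv_nth)
  then have pos: "\<forall>m\<in>set ms. m > 0" and n: "n > 0" by (auto simp: ns)
  have "N > 0" unfolding N_def using \<open>\<forall>m\<in>set ns. m > 0\<close> by (induction ns) auto
  have cpt: "compact (Sigmak ns k)" using compact_connected_Sigmak[OF \<open>k > 0\<close>] by blast
  have le: "prod_list ms \<le> n" using assms(4) by (simp add: ms_def n_def)
  {
    assume "k < (prod_list (butlast ns))\<^sup>2"
    then show "coord N ` Sigmak ns k \<in> null_sets (leb_tau N)"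
      using null_set_coord_Sigmak[OF pos \<open>k > 0\<close> _ le] cpt
      unfolding ns N_def leb_tau_def by (auto intro: null_sets_completionI)
  next
    assume "(prod_list (butlast ns))\<^sup>2 \<le> k"
    then obtain V where V: "open V" "tau1 N \<inter> V \<noteq> {}" "tau1 N \<inter> V \<subseteq> Sigmak ns k"
      using Sigmak_contains_open[OF pos n, of k] unfolding ns N_def by auto
    show "0 < emeasure (leb_tau N) (coord N ` Sigmak ns k)"
      using \<open>N > 0\<close> cpt V by (rule emeasure_coord_pos)
    show "\<exists>U. U \<noteq> {} \<and> U \<subseteq> Sigmak ns k \<and> openin (top_of_set (tau1 N)) U"
      using V by (intro exI[of _ "tau1 N \<inter> V"]) (auto simp: openin_open)
  }
qed

end
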